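(* Let $k=a_1+b+a_2+d$ be fixed. Then $\mathrm{split}(a_1,b,a_2,d)$ is minimized by the following arrangements: (i) if $k\equiv0\pmod{3}$, the minimum is at $(m,m,m,0)$, where $m=\frac{k}{3}$; (ii) if $k\equiv1\pmod{3}$, the minimum is at $(m-2,m,m,0)$, where $m=\frac{k+2}{3}$; and (iii) if $k\equiv2\pmod{3}$, the minimum is at $(m,m,m+2,0)$, where $m=\frac{k-2}{3}$. Moreover, the minimum number is asymptotic to $2^k/k$.
   Context: Let $[k]=\{1,\dots,k\}$. For $A,B\subseteq[k]$, $A$ splits $B$ if $|A\cap B|=|B|/2$ when $|B|$ is even, and $|A\cap B|=(|B|\pm1)/2$ when $|B|$ is odd. A splitter of a family $\mathcal B$ of subsets of $[k]$ is a set $A\subseteq[k]$ that splits every $B\in\mathcal B$. The arrangement of a two-set family $\mathcal B=\{B_1,B_2\}$ of subsets of $[k]$ is the quadruple $(a_1,b,a_2,d)$ with $a_1=|B_1\setminus B_2|$, $b=|B_1\cap B_2|$, $a_2=|B_2\setminus B_1|$, and $d=|B_1^c\cap B_2^c|$, where complements are taken in $[k]$. The number of splitters of $\mathcal B$ is determined by its arrangement, and $\mathrm{split}(a_1,b,a_2,d)$ denotes the number of splitters of a family with arrangement $(a_1,b,a_2,d)$.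
   Formalization: The minimum number is shown asymptotic to (2√3/π)·2^k/k rather than 2^k/k, since its ratio to 2^k/k tends to 2√3/π ≈ 1.103 and not to 1; case (ii) omits k=1, where (m-2,m,m,0)=(-1,1,1,0) is not an arrangement. *)

theory Defs
  imports "HOL-Analysis.Analysis" "HOL-Library.Landau_Symbols"
begin

definition splits :: "nat set \<Rightarrow> nat set \<Rightarrow> bool" where
  "splits A B \<longleftrightarrow>
     (if even (card B) then card (A \<inter> B) = card B div 2
      else card (A \<inter> B) = (card B - 1) div 2 \<or> card (A \<inter> B) = (card B + 1) div 2)"

definition splitters :: "nat \<Rightarrow> nat set set \<Rightarrow> nat set set" where
  "splitters k \<B> = {A. A \<subseteq> {1..k} \<and> (\<forall>B\<in>\<B>. splits A B)}"

type_synonym quadruple = "nat \<times> nat \<times> nat \<times> nat"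

definition arrangement :: "nat \<Rightarrow> nat set \<Rightarrow> nat set \<Rightarrow> quadruple" where
  "arrangement k B1 B2 =
     (card (B1 - B2), card (B1 \<inter> B2), card (B2 - B1), card (({1..k} - B1) \<inter> ({1..k} - B2)))"

definition arrangements :: "nat \<Rightarrow> quadruple set" where
  "arrangements k = {(a1, b, a2, d). a1 + b + a2 + d = k}"

text \<open>The description below determines a unique number, by \<open>split_count_arrangement\<close>
  and \<open>arrangement_exists\<close>. The sets \<open>B1\<close> and \<open>B2\<close> are not required to be distinct,
  so quadruples with \<open>a1 = a2 = 0\<close> are included.\<close>

definition split_count :: "quadruple \<Rightarrow> nat" where
  "split_count q = (THE n. \<exists>k B1 B2. B1 \<subseteq> {1..k} \<and> B2 \<subseteq> {1..k} \<and> arrangement k B1 B2 = q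
     \<and> n = card (splitters k {B1, B2}))"

text \<open>This minimum has order of magnitude \<open>2 ^ k / k\<close>, but its ratio to \<open>2 ^ k / k\<close> does not tend to 1.
  For \<open>k = 3 * m\<close> the arrangement \<open>(m, m, m, 0)\<close> has \<open>\<Sum>y\<le>m. (m choose y) ^ 3\<close> splitters
  (a Franel number), so the ratio tends to \<open>2 * sqrt 3 / pi\<close>.\<close>

definition min_split_count :: "nat \<Rightarrow> nat" where
  "min_split_count k = Min (split_count ` arrangements k)"

lemma arrangement_mem:
  assumes "B1 \<subseteq> {1..k}" "B2 \<subseteq> {1..k}"
  shows "arrangement k B1 B2 \<in> arrangements k"
proof -
  have fin: "finite B1" "finite B2"
    using assms finite_subset by blast+
  have "card {1..k} = card ((B1 - B2) \<union> (B1 \<inter> B2) \<union> (B2 - B1) \<union> (({1..k} - B1) \<inter> ({1..k} - B2)))"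
    using assms by (intro arg_cong[where f = card]) auto
  also have "\<dots> = card (B1 - B2) + card (B1 \<inter> B2) + card (B2 - B1)
      + card (({1..k} - B1) \<inter> ({1..k} - B2))"
    using fin by (subst card_Un_disjoint; (subst card_Un_disjoint)?; (subst card_Un_disjoint)?; auto)
  finally show ?thesis
    by (simp add: arrangement_def arrangements_def)
qed

lemma arrangement_exists:
  assumes "q \<in> arrangements k"
  shows "\<exists>B1 B2. B1 \<subseteq> {1..k} \<and> B2 \<subseteq> {1..k} \<and> arrangement k B1 B2 = q"
proof -
  obtain a1 b a2 d where q: "q = (a1, b, a2, d)" and k: "k = a1 + b + a2 + d"
    using assms by (auto simp: arrangements_def)
  let ?B1 = "{1..a1 + b}" and ?B2 = "{a1 + 1..a1 + b + a2}"
  have "?B1 - ?B2 = {1..a1}" "?B1 \<inter> ?B2 = {a1 + 1..a1 + b}" "?B2 - ?B1 = {a1 + b + 1..a1 + b + a2}"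
    "({1..k} - ?B1) \<inter> ({1..k} - ?B2) = {a1 + b + a2 + 1..k}"
    by (auto simp: k)
  then have "arrangement k ?B1 ?B2 = q"
    by (simp add: arrangement_def q k)
  moreover have "?B1 \<subseteq> {1..k}" "?B2 \<subseteq> {1..k}"
    by (auto simp: k)
  ultimately show ?thesis
    by blast
qed

lemma card_splitters_le:
  assumes B: "B1 \<subseteq> {1..k}" "B2 \<subseteq> {1..k}" and C: "C1 \<subseteq> {1..k}" "C2 \<subseteq> {1..k}"
    and eq: "arrangement k B1 B2 = arrangement k C1 C2"
  shows "card (splitters k {B1, B2}) \<le> card (splitters k {C1, C2})"
proof -
  have fin: "finite B1" "finite B2" "finite C1" "finite C2"
    using B C finite_subset by blast+
  let ?B = "\<lambda>i::nat. if i = 0 then B1 - B2 else if i = 1 then B1 \<inter> B2 else if i = 2 then B2 - B1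
              else ({1..k} - B1) \<inter> ({1..k} - B2)"
  let ?C = "\<lambda>i::nat. if i = 0 then C1 - C2 else if i = 1 then C1 \<inter> C2 else if i = 2 then C2 - C1
              else ({1..k} - C1) \<inter> ({1..k} - C2)"
  have "\<exists>g. bij_betw g (?B i) (?C i)" for i
    using eq fin by (intro finite_same_card_bij) (auto simp: arrangement_def)
  then obtain g where g: "\<And>i. bij_betw (g i) (?B i) (?C i)"
    by metis
  define f where "f x = (if x \<in> B1 - B2 then g 0 x else if x \<in> B1 \<inter> B2 then g 1 x
    else if x \<in> B2 - B1 then g 2 x else g 3 x)" for x
  have f0: "bij_betw f (B1 - B2) (C1 - C2)"
    using g[of 0] by (subst bij_betw_cong[where g = "g 0"]) (auto simp: f_def)
  have f1: "bij_betw f (B1 \<inter> B2) (C1 \<inter> C2)"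
    using g[of 1] by (subst bij_betw_cong[where g = "g 1"]) (auto simp: f_def)
  have f2: "bij_betw f (B2 - B1) (C2 - C1)"
    using g[of 2] by (subst bij_betw_cong[where g = "g 2"]) (auto simp: f_def)
  have f3: "bij_betw f (({1..k} - B1) \<inter> ({1..k} - B2)) (({1..k} - C1) \<inter> ({1..k} - C2))"
    using g[of 3] by (subst bij_betw_cong[where g = "g 3"]) (auto simp: f_def)
  have "bij_betw f ((B1 - B2) \<union> (B1 \<inter> B2)) ((C1 - C2) \<union> (C1 \<inter> C2))"
    by (rule bij_betw_combine[OF f0 f1]) auto
  then have fB1: "bij_betw f B1 C1"
    by (simp add: Un_Diff_Int)
  have "bij_betw f ((B2 - B1) \<union> (B1 \<inter> B2)) ((C2 - C1) \<union> (C1 \<inter> C2))"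
    by (rule bij_betw_combine[OF f2 f1]) auto
  moreover have "(B2 - B1) \<union> (B1 \<inter> B2) = B2" "(C2 - C1) \<union> (C1 \<inter> C2) = C2"
    by auto
  ultimately have fB2: "bij_betw f B2 C2"
    by simp
  have "bij_betw f (B1 \<union> (B2 - B1)) (C1 \<union> (C2 - C1))"
    by (rule bij_betw_combine[OF fB1 f2]) auto
  then have "bij_betw f ((B1 \<union> (B2 - B1)) \<union> (({1..k} - B1) \<inter> ({1..k} - B2)))
      ((C1 \<union> (C2 - C1)) \<union> (({1..k} - C1) \<inter> ({1..k} - C2)))"
    by (rule bij_betw_combine[OF _ f3]) auto
  moreover have "(B1 \<union> (B2 - B1)) \<union> (({1..k} - B1) \<inter> ({1..k} - B2)) = {1..k}"
    "(C1 \<union> (C2 - C1)) \<union> (({1..k} - C1) \<inter> ({1..k} - C2)) = {1..k}"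
    using B C by auto
  ultimately have f: "bij_betw f {1..k} {1..k}"
    by simp
  then have inj: "inj_on f {1..k}" and img: "f ` {1..k} = {1..k}"
    by (auto simp: bij_betw_def)
  have spl: "splits (f ` A) (f ` B)" if "A \<subseteq> {1..k}" "B \<subseteq> {1..k}" "splits A B" for A B
  proof -
    have "f ` A \<inter> f ` B = f ` (A \<inter> B)"
      using inj_on_image_Int[OF inj that(1,2)] by simp
    moreover have "card (f ` B) = card B" "card (f ` (A \<inter> B)) = card (A \<inter> B)"
      using that by (auto intro!: card_image inj_on_subset[OF inj])
    ultimately show ?thesis
      using that(3) unfolding splits_def by metis
  qed
  have imgs: "f ` B1 = C1" "f ` B2 = C2"
    using fB1 fB2 by (auto simp: bij_betw_def)
  have "(`) f ` splitters k {B1, B2} \<subseteq> splitters k {C1, C2}"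
  proof
    fix A'
    assume "A' \<in> (`) f ` splitters k {B1, B2}"
    then obtain A where A: "A' = f ` A" "A \<subseteq> {1..k}" "splits A B1" "splits A B2"
      by (auto simp: splitters_def)
    have "f ` A \<subseteq> {1..k}"
      using image_mono[OF A(2), of f] img by simp
    then show "A' \<in> splitters k {C1, C2}"
      using spl[OF A(2) B(1) A(3)] spl[OF A(2) B(2) A(4)] imgs A(1) by (simp add: splitters_def)
  qed
  moreover have "inj_on ((`) f) (splitters k {B1, B2})"
    by (rule inj_on_subset[OF inj_on_image_Pow[OF inj]]) (auto simp: splitters_def)
  moreover have "finite (splitters k {C1, C2})"
    by (rule finite_subset[of _ "Pow {1..k}"]) (auto simp: splitters_def)
  ultimately show ?thesis
    using card_inj_on_le by blast
qed

lemma split_count_arrangement: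
  assumes "B1 \<subseteq> {1..k}" "B2 \<subseteq> {1..k}"
  shows "split_count (arrangement k B1 B2) = card (splitters k {B1, B2})"
  unfolding split_count_def
proof (rule the_equality)
  show "\<exists>k' C1 C2. C1 \<subseteq> {1..k'} \<and> C2 \<subseteq> {1..k'} \<and> arrangement k' C1 C2 = arrangement k B1 B2
      \<and> card (splitters k {B1, B2}) = card (splitters k' {C1, C2})"
    using assms by blast
next
  fix n
  assume "\<exists>k' C1 C2. C1 \<subseteq> {1..k'} \<and> C2 \<subseteq> {1..k'} \<and> arrangement k' C1 C2 = arrangement k B1 B2
      \<and> n = card (splitters k' {C1, C2})"
  then obtain k' C1 C2 where C: "C1 \<subseteq> {1..k'}" "C2 \<subseteq> {1..k'}"
    "arrangement k' C1 C2 = arrangement k B1 B2" "n = card (splitters k' {C1, C2})"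
    by blast
  have "k' = k"
    using arrangement_mem[OF assms] arrangement_mem[OF C(1,2)] C(3)
    by (auto simp: arrangements_def)
  then show "n = card (splitters k {B1, B2})"
    using card_splitters_le[of B1 k B2 C1 C2] card_splitters_le[of C1 k C2 B1 B2] assms C
    by simp
qed

end

theory Submission
  imports Defs "HOL-Probability.Distributions" "HOL-Real_Asymp.Real_Asymp"
begin

text \<open>
  Reading a set as a choice of signs on the ground set turns splitters into random walks. On each of
  the three cells of the Venn diagram a subset becomes a walk with steps \<open>1\<close> and \<open>-1\<close>; after the
  signs on the middle cell are reversed, a splitter is a triple of walks whose end points differ by
  at most one from that of the middle walk. A parity mismatch between two cells is absorbed by one
  more step of an outer walk. Hence the number of splitters is \<open>2 ^ d\<close> times the number
  \<open>meets p q r\<close> of triples of walks, of lengths \<open>p\<close>, \<open>q\<close>, \<open>r\<close> of the same parity, that end at a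
  common point (\<open>split_count_eq_meets\<close>).

  For a given sum of the lengths, \<open>meets\<close> does not increase when two lengths move closer together
  (\<open>meets_swap\<close>): the distribution of the meeting point of these two walks keeps its total
  mass but spreads out, while the weight of the third walk decreases away from the origin. So the
  most balanced triples are the best ones (\<open>balanced_meets_le\<close>). The number for these grows with
  the total length, and at most doubles for one more step (\<open>balanced_meets_mono\<close>,
  \<open>balanced_meets_Suc_le\<close>). The latter comes from \<open>(x + y)\<^sup>2 \<le> 2 * (x\<^sup>2 + y\<^sup>2)\<close> and shows that a
  point outside both sets, which doubles the number of splitters, is never better than
  a further step. It follows that a most balanced arrangement with \<open>d = 0\<close> is a minimum for
  every \<open>k \<noteq> 1\<close>.

  The doubling inequality also makes \<open>balanced_meets k / 2 ^ k\<close> antitone, so its asymptotics can be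
  read off along the single progression \<open>k = 18 * n + 6\<close>, where the value is the Franel number of
  three walks of length \<open>2 * (3 * n + 1)\<close>. Divided by the cube of its central term, the Franel sum
  is bounded above by a Gaussian sum and below by a sum of central ratios for walks of length
  \<open>2 * n\<close>, which is a full row of Pascal's triangle. Together with the product of Wallis for the
  central term this gives the constant \<open>2 * sqrt 3 / pi\<close>.
\<close>

section \<open>Simple walks on the integers\<close>

text \<open>The number of walks of length \<open>n\<close> from \<open>0\<close> to \<open>s\<close>, that is the binomial coefficient of \<open>n\<close> and
  \<open>(n + s) / 2\<close>. Letting \<open>s\<close> range over all integers, with value \<open>0\<close> when the parity is wrong,
  removes case distinctions at the boundary.\<close>

primrec walks :: "nat \<Rightarrow> int \<Rightarrow> int" where
  "walks 0 s = (if s = 0 then 1 else 0)"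
| "walks (Suc n) s = walks n (s - 1) + walks n (s + 1)"

definition walk_sum :: "nat \<Rightarrow> (int \<Rightarrow> int) \<Rightarrow> int" where
  "walk_sum n f = (\<Sum>s\<in>{- int n..int n}. walks n s * f s)"

lemma walk_sum_0 [simp]: "walk_sum 0 f = f 0"
  by (simp add: walk_sum_def)

lemma walks_nonneg: "0 \<le> walks n s"
  by (induction n arbitrary: s) auto

lemma walks_eq_0: "int n < \<bar>s\<bar> \<Longrightarrow> walks n s = 0"
  by (induction n arbitrary: s) auto

lemma walks_parity: "odd (int n + s) \<Longrightarrow> walks n s = 0"
  by (induction n arbitrary: s) auto

lemma walks_minus: "walks n (- s) = walks n s"
proof (induction n arbitrary: s)
  case (Suc n)
  have "- s - 1 = - (s + 1)" "- s + 1 = - (s - 1)"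
    by auto
  then show ?case
    by (simp only: walks.simps Suc add.commute)
qed simp

lemma walk_sum_superset:
  assumes "finite S" "{- int n..int n} \<subseteq> S"
  shows "walk_sum n f = (\<Sum>s\<in>S. walks n s * f s)"
  unfolding walk_sum_def using assms
  by (intro sum.mono_neutral_left) (auto intro!: walks_eq_0)

text \<open>Summation by parts: the last step is moved from the walk to the summand. This is what relates
  sums over end points of different parity.\<close>

lemma walk_sum_Suc: "walk_sum (Suc n) f = walk_sum n (\<lambda>s. f (s - 1) + f (s + 1))"
proof -
  let ?S = "{- int n - 1..int n + 1}"
  have "{- int (Suc n)..int (Suc n)} = ?S"
    by auto
  then   have "walk_sum (Suc n) f = (\<Sum>s\<in>?S. walks n (s - 1) * f s) + (\<Sum>s\<in>?S. walks n (s + 1) * f s)"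
    unfolding walk_sum_def by (simp only: walks.simps sum.distrib distrib_right)
  also have "(\<Sum>s\<in>?S. walks n (s - 1) * f s) = (\<Sum>s\<in>{- int n - 2..int n}. walks n s * f (s + 1))"
    by (rule sum.reindex_bij_witness[of _ "\<lambda>s. s + 1" "\<lambda>s. s - 1"]) auto
  also have "\<dots> = walk_sum n (\<lambda>s. f (s + 1))"
    by (rule walk_sum_superset[symmetric]) auto
  also have "(\<Sum>s\<in>?S. walks n (s + 1) * f s) = (\<Sum>s\<in>{- int n..int n + 2}. walks n s * f (s - 1))"
    by (rule sum.reindex_bij_witness[of _ "\<lambda>s. s - 1" "\<lambda>s. s + 1"]) auto
  also have "\<dots> = walk_sum n (\<lambda>s. f (s - 1))"
    by (rule walk_sum_superset[symmetric]) auto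
  finally show ?thesis
    by (simp add: walk_sum_def sum.distrib distrib_left)
qed

lemma walk_sum_Suc_walks: "walk_sum (Suc p) (walks q) = walk_sum p (walks (Suc q))"
  unfolding walk_sum_Suc by (intro arg_cong[where f = "walk_sum p"] ext) simp

lemma walk_sum_mono: "(\<And>s. f s \<le> g s) \<Longrightarrow> walk_sum n f \<le> walk_sum n g"
  unfolding walk_sum_def by (intro sum_mono mult_left_mono) (auto simp: walks_nonneg)

lemma walk_sum_cong:
  "(\<And>s. even (int n + s) \<Longrightarrow> f s = g s) \<Longrightarrow> walk_sum n f = walk_sum n g"
  unfolding walk_sum_def using walks_parity[of n]
  by (intro sum.cong refl) (metis mult_zero_left)

lemma walk_sum_indicator: "walk_sum n (\<lambda>s. if s = t then 1 else 0) = walks n t"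
  by (subst walk_sum_superset[of "insert t {- int n..int n}"])
    (auto simp: if_distrib sum.delta' cong: if_cong)

lemma walk_sum_one: "walk_sum n (\<lambda>s. c) = c * 2 ^ n"
  by (induction n arbitrary: c) (auto simp: walk_sum_Suc walk_sum_def[of 0] simp flip: mult_2)

text \<open>The absorption identity for binomial coefficients, in terms of end points.\<close>

lemma walks_step_down: "(int n + 1 + s) * walks (Suc n) s = 2 * (int n + 1) * walks n (s - 1)"
proof (induction n arbitrary: s)
  case (Suc n)
  have 1: "(int n + s) * walks (Suc n) (s - 1) = 2 * (int n + 1) * walks n (s - 2)"
    using Suc[of "s - 1"] by (simp add: algebra_simps)
  have 2: "(int n + s + 2) * walks (Suc n) (s + 1) = 2 * (int n + 1) * walks n s"
    using Suc[of "s + 1"] by (simp add: algebra_simps)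
  have "(int (Suc n) + 1 + s) * walks (Suc (Suc n)) s
      = (int n + s) * walks (Suc n) (s - 1) + (int n + s + 2) * walks (Suc n) (s + 1)
        + 2 * walks (Suc n) (s - 1)"
    by (simp add: algebra_simps)
  also have "\<dots> = 2 * (int n + 1) * (walks n (s - 2) + walks n s) + 2 * walks (Suc n) (s - 1)"
    unfolding 1 2 by (simp add: algebra_simps)
  also have "walks n (s - 2) + walks n s = walks (Suc n) (s - 1)"
    by simp
  finally show ?case by (simp add: algebra_simps)
qed auto

lemma walks_step_up: "(int n + 1 - s) * walks (Suc n) s = 2 * (int n + 1) * walks n (s + 1)"
proof -
  have "- s - 1 = - (s + 1)"
    by simp
  then show ?thesis
    using walks_step_down[of n "- s"]
    by (simp only: walks_minus diff_conv_add_uminus[symmetric])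
qed

text \<open>Two steps keep the parity of the end point, and the quotient of the two numbers of walks is
  a rational function of \<open>s\<^sup>2\<close>; the comparison of two such quotients decides \<open>meets_swap\<close>.\<close>

lemma walks_two_steps:
  "((int n + 2)\<^sup>2 - s\<^sup>2) * walks (n + 2) s = 4 * (int n + 2) * (int n + 1) * walks n s"
proof -
  have "((int n + 2)\<^sup>2 - s\<^sup>2) * walks (n + 2) s
      = (int n + 2 - s) * ((int n + 2 + s) * walks (Suc (Suc n)) s)"
    by (simp add: power2_eq_square algebra_simps)
  also have "(int n + 2 + s) * walks (Suc (Suc n)) s = 2 * (int n + 2) * walks (Suc n) (s - 1)"
    using walks_step_down[of "Suc n" s] by (simp add: algebra_simps)
  also have "(int n + 2 - s) * (2 * (int n + 2) * walks (Suc n) (s - 1))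
     = 2 * (int n + 2) * ((int n + 1 - (s - 1)) * walks (Suc n) (s - 1))"
    by (simp add: algebra_simps)
  also have "\<dots> = 4 * (int n + 2) * (int n + 1) * walks n s"
    unfolding walks_step_up by (simp add: algebra_simps)
  finally show ?thesis .
qed

lemma walks_shift: "(int n + s + 2) * walks n (s + 2) = (int n - s) * walks n s"
proof (cases n)
  case (Suc m)
  then show ?thesis
    using walks_step_down[of m "s + 2"] walks_step_up[of m s] by (simp add: algebra_simps)
qed auto

lemma walks_antitone_step: "- 1 \<le> s \<Longrightarrow> walks n (s + 2) \<le> walks n s"
proof (induction n arbitrary: s)
  case (Suc n)
  show ?case
  proof (cases "s = - 1")
    case True
    then show ?thesis using walks_minus[of "Suc n" 1] by simp
  next
    case False
    then show ?thesis
      using Suc.IH[of "s - 1"] Suc.IH[of "s + 1"] Suc.prems by (simp add: algebra_simps)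
  qed
qed auto

lemma walks_antitone:
  assumes "\<bar>s\<bar> \<le> \<bar>t\<bar>" "even (s + t)"
  shows "walks n t \<le> walks n s"
proof -
  have *: "walks n (\<bar>s\<bar> + 2 * int j) \<le> walks n \<bar>s\<bar>" for j
  proof (induction j)
    case (Suc j)
    have "walks n (\<bar>s\<bar> + 2 * int j + 2) \<le> walks n (\<bar>s\<bar> + 2 * int j)"
      by (rule walks_antitone_step) simp
    then show ?case using Suc by (simp add: algebra_simps)
  qed simp
  have "even (\<bar>t\<bar> - \<bar>s\<bar>)" using assms(2) by auto
  then obtain i where i: "\<bar>t\<bar> - \<bar>s\<bar> = 2 * i" by blast
  with assms(1) have "\<bar>t\<bar> = \<bar>s\<bar> + 2 * int (nat i)" by simp
  with * have "walks n \<bar>t\<bar> \<le> walks n \<bar>s\<bar>" by metis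
  then show ?thesis by (simp add: abs_if walks_minus split: if_splits)
qed

section \<open>Triples of walks with a common end point\<close>

definition meets :: "nat \<Rightarrow> nat \<Rightarrow> nat \<Rightarrow> int" where
  "meets p q r = walk_sum p (\<lambda>s. walks q s * walks r s)"

lemma meets_superset:
  assumes "p + q + r \<le> n"
  shows "meets p q r = (\<Sum>s\<in>{- int n..int n}. walks p s * walks q s * walks r s)"
  unfolding meets_def using assms
  by (subst walk_sum_superset[of "{- int n..int n}"]) (auto simp: mult.assoc)

lemma meets_commute: "meets p q r = meets q p r" "meets p q r = meets p r q"
  by (simp_all add: meets_superset[OF order_refl] ac_simps)

lemma meets_add2:  "2 * meets p q r \<le> meets (p + 2) q r"
proof -
  have "2 * walks p s \<le> walks (p + 2) s" for s
    using walks_nonneg[of p "s - 2"] walks_nonneg[of p "s + 2"] by (simp add: add.commute)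
  then have "2 * walks p s * (walks q s * walks r s) \<le> walks (p + 2) s * (walks q s * walks r s)" for s
    by (intro mult_right_mono mult_nonneg_nonneg walks_nonneg)
  then show ?thesis
    by (simp add: meets_superset[of _ _ _ "p + q + r + 2"] sum_distrib_left sum_mono mult.assoc)
qed

text \<open>Taking one step from each of the two equal walks and giving one step to the third. Conditioned
  on the position \<open>s\<close> of the walk of length \<open>r\<close>, let \<open>x\<close> and \<open>y\<close> be the numbers of walks of length
  \<open>q\<close> that end at \<open>s - 1\<close> and \<open>s + 1\<close>. The left side counts \<open>(x + y)\<^sup>2\<close> and the right side
  \<open>2 * (x\<^sup>2 + y\<^sup>2)\<close>.\<close>

lemma meets_square: "meets (q + 1) (q + 1) r \<le> 2 * meets q q (r + 1)"
proof -
  let ?w = "walks q"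
  have diag: "meets p p r = walk_sum r (\<lambda>s. walks p s * walks p s)" for p r
    by (metis meets_commute meets_def)
  have "meets (q + 1) (q + 1) r = walk_sum r (\<lambda>s. (?w (s - 1) + ?w (s + 1)) * (?w (s - 1) + ?w (s + 1)))"
    by (simp add: diag)
  also have "\<dots> \<le> walk_sum r (\<lambda>s. 2 * (?w (s - 1) * ?w (s - 1) + ?w (s + 1) * ?w (s + 1)))"
  proof (rule walk_sum_mono)
    fix s
    have "0 \<le> (?w (s - 1) - ?w (s + 1)) * (?w (s - 1) - ?w (s + 1))"
      by simp
    then show "(?w (s - 1) + ?w (s + 1)) * (?w (s - 1) + ?w (s + 1))
        \<le> 2 * (?w (s - 1) * ?w (s - 1) + ?w (s + 1) * ?w (s + 1))"
      by (simp add: algebra_simps)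
  qed
  also have "\<dots> = 2 * walk_sum (r + 1) (\<lambda>s. ?w s * ?w s)"
    by (simp add: walk_sum_Suc) (simp add: walk_sum_def sum_distrib_left algebra_simps)
  also have "walk_sum (r + 1) (\<lambda>s. ?w s * ?w s) = meets q q (r + 1)"
    by (simp add: diag)
  finally show ?thesis .
qed

text \<open>Balancing two lengths. The two products of walk numbers have the same sum over all \<open>s\<close>, since
  both sums count the closed walks of length \<open>p + q + 2\<close>. Their difference \<open>D s\<close> is
  nonnegative for small \<open>s\<^sup>2\<close> and nonpositive for large \<open>s\<^sup>2\<close>. As \<open>walks r s\<close> does not increase
  with \<open>s\<^sup>2\<close> among the \<open>s\<close> of one parity, the weighted sum of \<open>D\<close> is nonnegative.\<close>

lemma meets_swap:
  assumes qp: "q \<le> p" and par: "even (p + q)"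
  shows "meets p (q + 2) r \<le> meets (p + 2) q r"
proof -
  define n where "n = p + q + r + 2"
  define S where "S = {s \<in> {- int n..int n}. even (int q + s)}"
  have finS: "finite S"
    unfolding S_def by (rule finite_subset[of _ "{- int n..int n}"]) auto
  define D where "D s = walks (p + 2) s * walks q s - walks p s * walks (q + 2) s" for s
  \<comment> \<open>The sign of \<open>D s\<close> is read off \<open>D_factor\<close> below: it changes at the bound in \<open>inner\<close>.\<close>
  define inner where "inner s \<longleftrightarrow> s\<^sup>2 * (int p + int q + 3) \<le> (int p + 2) * (int q + 2)" for s
  have diff: "meets (p + 2) q r - meets p (q + 2) r = (\<Sum>s\<in>S. D s * walks r s)"
  proof -
    have "meets (p + 2) q r - meets p (q + 2) r = (\<Sum>s\<in>{- int n..int n}. D s * walks r s)"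
      by (subst (1 2) meets_superset[of _ _ _ n])
        (auto simp: n_def D_def sum_subtractf[symmetric] algebra_simps)
    also have "\<dots> = (\<Sum>s\<in>S. D s * walks r s)"
      using par by (intro sum.mono_neutral_right) (auto simp: S_def D_def walks_parity)
    finally show ?thesis .
  qed
  have sumD: "(\<Sum>s\<in>S. D s) = 0"
  proof -
    have 1: "walk_sum (p + 2) (walks q) = walk_sum p (walks (q + 2))"
      by (simp add: walk_sum_Suc_walks)
    have "(\<Sum>s\<in>S. D s) = (\<Sum>s\<in>{- int n..int n}. D s)"
      using par by (intro sum.mono_neutral_left) (auto simp: S_def D_def walks_parity)
    also have "\<dots> = walk_sum (p + 2) (walks q) - walk_sum p (walks (q + 2))"
      by (subst (1 2) walk_sum_superset[of "{- int n..int n}"])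
        (auto simp: n_def D_def sum_subtractf[symmetric])
    finally show ?thesis using 1 by simp
  qed
  have D_factor: "((int p + 2)\<^sup>2 - s\<^sup>2) * ((int q + 2)\<^sup>2 - s\<^sup>2) * D s
    = 4 * walks p s * walks q s * (int p - int q)
      * ((int p + 2) * (int q + 2) - s\<^sup>2 * (int p + int q + 3))" for s
  proof -
    define x y z where "x = (int p + 2)\<^sup>2 - s\<^sup>2" and "y = (int q + 2)\<^sup>2 - s\<^sup>2" and "z = s\<^sup>2"
    have "x * y * D s = (x * walks (p + 2) s) * y * walks q s - x * walks p s * (y * walks (q + 2) s)"
      by (simp add: D_def algebra_simps)
    also have "\<dots> = 4 * walks p s * walks q s
        * ((int p + 2) * (int p + 1) * y - (int q + 2) * (int q + 1) * x)"
      unfolding x_def y_def walks_two_steps by (simp add: algebra_simps)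
    also have "(int p + 2) * (int p + 1) * y - (int q + 2) * (int q + 1) * x
        = (int p - int q) * ((int p + 2) * (int q + 2) - z * (int p + int q + 3))"
      unfolding x_def y_def z_def[symmetric] by (simp add: algebra_simps power2_eq_square)
    finally show ?thesis by (simp add: x_def y_def z_def mult.assoc)
  qed
  have inner_less: "\<bar>s\<bar> < int q + 2" if "inner s" for s
  proof (rule ccontr)
    assume "\<not> ?thesis"
    then have "(int q + 2)\<^sup>2 \<le> s\<^sup>2" by (simp add: abs_le_square_iff[symmetric])
    then have "(int q + 2)\<^sup>2 * (int p + int q + 3) \<le> (int p + 2) * (int q + 2)"
      using that unfolding inner_def by (meson mult_right_mono order_trans of_nat_0_le_iff add_nonneg_nonneg zero_le_numeral)
    then have "(int q + 2) * (int p + int q + 3) \<le> int p + 2"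
      by (simp add: power2_eq_square mult.assoc)
    moreover have "1 * (int p + int q + 3) \<le> (int q + 2) * (int p + int q + 3)"
      by (rule mult_right_mono) auto
    ultimately have "1 * (int p + int q + 3) \<le> int p + 2"
      by (rule order_trans[rotated])
    then show False by simp
  qed
  have pos: "0 < ((int p + 2)\<^sup>2 - s\<^sup>2) * ((int q + 2)\<^sup>2 - s\<^sup>2)" if "\<bar>s\<bar> < int q + 2" for s
  proof -
    have "s\<^sup>2 < (int q + 2)\<^sup>2" "s\<^sup>2 < (int p + 2)\<^sup>2"
      using that qp abs_le_square_iff[of "int q + 2" s] abs_le_square_iff[of "int p + 2" s] by auto
    then show ?thesis by simp
  qed
  have D_inner: "0 \<le> D s" if "inner s" for s
  proof -
    have "0 \<le> ((int p + 2)\<^sup>2 - s\<^sup>2) * ((int q + 2)\<^sup>2 - s\<^sup>2) * D s"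
      unfolding D_factor using that qp walks_nonneg by (simp add: inner_def)
    then show ?thesis using pos[OF inner_less[OF that]] by (simp add: zero_le_mult_iff)
  qed
  have D_outer: "D s \<le> 0" if "\<not> inner s" for s
  proof (cases "\<bar>s\<bar> < int q + 2")
    case True
    have "((int p + 2)\<^sup>2 - s\<^sup>2) * ((int q + 2)\<^sup>2 - s\<^sup>2) * D s \<le> 0"
      unfolding D_factor using that qp walks_nonneg
      by (intro mult_nonneg_nonpos) (auto simp: inner_def)
    then show ?thesis using mult_pos_pos[OF pos[OF True], of "D s"] by linarith
  next
    case False
    then show ?thesis by (simp add: D_def walks_eq_0 walks_nonneg)
  qed
  \<comment> \<open>A level of \<open>walks r\<close> separating its values inside from those outside. Subtracting it does not
    change the weighted sum, because \<open>D\<close> sums to \<open>0\<close>, and makes every term nonnegative.\<close>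
  define c where "c = Max (insert 0 (walks r ` {s \<in> S. \<not> inner s}))"
  have fin: "finite (insert 0 (walks r ` {s \<in> S. \<not> inner s}))"
    using finS by simp
  have "0 \<le> D s * (walks r s - c)" if s: "s \<in> S" for s
  proof (cases "inner s")
    case True
    have "c \<le> walks r s"
      unfolding c_def
    proof (subst Max_le_iff[OF fin], simp, intro ballI)
      fix w
      assume "w \<in> insert 0 (walks r ` {s \<in> S. \<not> inner s})"
      then consider "w = 0" | t where "w = walks r t" "t \<in> S" "\<not> inner t" by auto
      then show "w \<le> walks r s"
      proof cases
        case 2
        have "s\<^sup>2 * (int p + int q + 3) < t\<^sup>2 * (int p + int q + 3)"
          using True 2(3) unfolding inner_def by linarith
        then have "s\<^sup>2 < t\<^sup>2"
          by (rule mult_right_less_imp_less) simp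
        then have "\<bar>s\<bar> \<le> \<bar>t\<bar>" by (simp add: abs_le_square_iff)
        then show ?thesis using s 2 by (auto simp: S_def intro!: walks_antitone)
      qed (simp add: walks_nonneg)
    qed
    then show ?thesis using D_inner[OF True] by simp
  next
    case False
    have "walks r s \<le> c"
      unfolding c_def using fin s False by (intro Max_ge) auto
    then show ?thesis using D_outer[OF False] by (simp add: mult_nonpos_nonpos)
  qed
  then have "0 \<le> (\<Sum>s\<in>S. D s * (walks r s - c))" by (rule sum_nonneg)
  also have "\<dots> = (\<Sum>s\<in>S. D s * walks r s) - (\<Sum>s\<in>S. D s) * c"
    by (simp add: right_diff_distrib sum_subtractf sum_distrib_right)
  finally show ?thesis using diff sumD by simp
qed

section \<open>Most balanced triples\<close>

text \<open>The value of \<open>meets\<close> at the triple with sum \<open>n\<close> and lengths of equal parity that differ by at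
  most two. There is no triple of equal parity with sum \<open>1\<close>; the value \<open>1\<close> is chosen there
  because it keeps the inequalities between consecutive values valid across this gap.\<close>

definition balanced_meets :: "nat \<Rightarrow> int" where
  "balanced_meets n =
     (if n = 1 then 1
      else if n mod 3 = 0 then meets (n div 3) (n div 3) (n div 3)
      else if n mod 3 = 1 then meets (n div 3 - 1) (n div 3 + 1) (n div 3 + 1)
      else meets (n div 3) (n div 3) (n div 3 + 2))"

lemma balanced_meets_simps:
  "balanced_meets (3 * m) = meets m m m"
  "balanced_meets 1 = 1"
  "balanced_meets (3 * m + 4) = meets m (m + 2) (m + 2)"
  "balanced_meets (3 * m + 2) = meets m m (m + 2)"
proof -
  have "(3 * m + 4) mod 3 = 1" "(3 * m + 4) div 3 = m + 1" "(3 * m + 2) mod 3 = 2" "(3 * m + 2) div 3 = m"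
    "3 * m \<noteq> 1"
    by presburger+
  then show "balanced_meets (3 * m) = meets m m m"
    "balanced_meets 1 = 1"
    "balanced_meets (3 * m + 4) = meets m (m + 2) (m + 2)"
    "balanced_meets (3 * m + 2) = meets m m (m + 2)"
    by (simp_all add: balanced_meets_def)
qed

lemma nat_mod3_cases:
  obtains m where "n = 3 * m" | "n = 1" | m where "n = 3 * m + 4" | m where "n = 3 * m + (2::nat)"
proof -
  have "n = 3 * (n div 3) \<or> n = 1 \<or> n = 3 * ((n - 4) div 3) + 4 \<or> n = 3 * (n div 3) + 2"
    by presburger
  then show ?thesis using that by metis
qed

text \<open>Repeated balancing of the longest and the shortest walk; the sum of the squares of the lengths
  decreases each time.\<close>

lemma balanced_meets_le:
  assumes "even (p + q)" "even (q + r)"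
  shows "balanced_meets (p + q + r) \<le> meets p q r"
  using assms
proof (induction "p * p + q * q + r * r" arbitrary: p q r rule: less_induct)
  case less
  let ?Q = "\<lambda>a b c. balanced_meets (a + b + c) \<le> meets a b c"
  have swap: "?Q a b c \<longleftrightarrow> ?Q b a c" "?Q a b c \<longleftrightarrow> ?Q a c b" for a b c
    by (simp only: meets_commute(1)[of a b c] add.commute[of a b])
      (simp only: meets_commute(2)[of a b c] add.assoc add.commute[of b c])
  have near: "b = a \<and> c = a \<or> b = a \<and> c = a + 2 \<or> b = a + 2 \<and> c = a + 2"
    if "a \<le> b" "b \<le> c" "c \<le> a + 2" "even (a + b)" "even (b + c)" for a b c :: nat
    using that by presburger
  have sorted: "?Q a b c"
    if "a \<le> b" "b \<le> c" and par: "even (a + b)" "even (b + c)"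
      and measure: "a * a + b * b + c * c = p * p + q * q + r * r" for a b c
  proof (cases "c \<le> a + 2")
    case True
    then consider "b = a" "c = a" | "b = a" "c = a + 2" | "b = a + 2" "c = a + 2"
      using near[OF \<open>a \<le> b\<close> \<open>b \<le> c\<close> True] par by blast
    then show ?thesis
    proof cases
      case 1
      have "a + a + a = 3 * a" by simp
      then show ?thesis unfolding 1 by (simp only: balanced_meets_simps order_refl)
    next
      case 2
      have "a + a + (a + 2) = 3 * a + 2" by simp
      then show ?thesis unfolding 2 by (simp only: balanced_meets_simps order_refl)
    next
      case 3
      have "a + (a + 2) + (a + 2) = 3 * a + 4" by simp
      then show ?thesis unfolding 3 by (simp only: balanced_meets_simps order_refl)
    qed
  next
    case False
    define e where "e = c - 2"
    have "even (a + c)" using par by auto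
    then have "c \<noteq> a + 3" by auto
    then have e: "c = e + 2" "a + 2 \<le> e"
      using False by (simp_all add: e_def)
    with \<open>even (a + c)\<close> have "even (e + a)"
      by simp
    note e = e this
    have "c * c + a * a = e * e + (a + 2) * (a + 2) + 4 * (e - a)"
      using e by (simp add: algebra_simps diff_mult_distrib2)
    then have "(a + 2) * (a + 2) + b * b + e * e < p * p + q * q + r * r"
      using e measure by linarith
    then have "?Q (a + 2) b e"
      by (rule less.hyps) (use e par in auto)
    then have "balanced_meets (a + b + c) \<le> meets (a + 2) b e"
      using e by (simp add: add_ac)
    also have "\<dots> = meets e (a + 2) b"
      using meets_commute by metis
    also have "\<dots> \<le> meets (e + 2) a b"
      using meets_swap[of a e b] e by simp
    also have "\<dots> = meets a b c"
      using meets_commute e by metis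
    finally show ?thesis .
  qed
  consider "p \<le> q" "q \<le> r" | "p \<le> r" "r \<le> q" | "q \<le> p" "p \<le> r"
    | "q \<le> r" "r \<le> p" | "r \<le> p" "p \<le> q" | "r \<le> q" "q \<le> p"
    by linarith
  then show ?case
  proof cases
    case 1
    then show ?thesis using less.prems by (intro sorted) auto
  next
    case 2
    then have "?Q p r q" using less.prems by (intro sorted) auto
    then show ?thesis by (subst swap(2))
  next
    case 3
    then have "?Q q p r" using less.prems by (intro sorted) auto
    then show ?thesis by (subst swap(1))
  next
    case 4
    then have "?Q q r p" using less.prems by (intro sorted) auto
    then show ?thesis by (subst swap(1), subst swap(2))
  next
    case 5
    then have "?Q r p q" using less.prems by (intro sorted) auto
    then show ?thesis by (subst swap(2), subst swap(1))
  next
    case 6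
    then have "?Q r q p" using less.prems by (intro sorted) auto
    then show ?thesis by (subst swap(1), subst swap(2), subst swap(1))
  qed
qed

text \<open>One more step at most doubles the number. Except for \<open>n = 0, 1, 4\<close>, where the values are
  computed, this is \<open>meets_square\<close>, followed by one balancing move when \<open>n mod 3 = 1\<close>.\<close>

lemma balanced_meets_Suc_le: "balanced_meets (n + 1) \<le> 2 * balanced_meets n"
proof (cases n rule: nat_mod3_cases)
  case (1 m)
  show ?thesis
  proof (cases m)
    case 0
    then show ?thesis using 1 balanced_meets_simps(1)[of 0] balanced_meets_simps(2)
      by (simp add: meets_def)
  next
    case (Suc l)
    then have "n + 1 = 3 * l + 4" using 1 by simp
    then have "balanced_meets (n + 1) = meets l (l + 2) (l + 2)"
      by (simp only: balanced_meets_simps)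
    also have "\<dots> = meets (l + 1 + 1) (l + 1 + 1) l"
      unfolding add.assoc one_add_one
      using meets_commute(1)[of l "l + 2" "l + 2"] meets_commute(2)[of "l + 2" l "l + 2"] by simp
    also have "\<dots> \<le> 2 * balanced_meets n"
      using meets_square[of "l + 1" l] 1 Suc by (simp only: balanced_meets_simps Suc_eq_plus1)
    finally show ?thesis .
  qed
next
  case 2
  then show ?thesis using balanced_meets_simps(2) balanced_meets_simps(4)[of 0]
    by (simp add: meets_def numeral_2_eq_2)
next
  case (3 l)
  have "n + 1 = 3 * (l + 1) + 2" using 3 by simp
  then have "balanced_meets (n + 1) = meets (l + 1) (l + 1) (l + 3)"
    by (simp only: balanced_meets_simps add.assoc) (simp add: numeral_3_eq_3)
  also have "\<dots> \<le> 2 * meets l (l + 2) (l + 2)"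
  proof (cases l)
    case 0
    then show ?thesis
      by (simp add: meets_def walk_sum_Suc numeral_eq_Suc)
  next
    case (Suc i)
    have "l + 1 = i + 2" "l + 3 = i + 4"
      using Suc by simp_all
    then have "meets (l + 1) (l + 1) (l + 3) = meets (i + 2) (i + 2) (i + 4)"
      by (simp only:)
    also have "\<dots> \<le> meets (i + 2 + 2) i (i + 4)"
      using meets_swap[of i "i + 2" "i + 4"] by simp
    also have "\<dots> = meets (i + 3 + 1) (i + 3 + 1) i"
    proof -
      have "i + 2 + 2 = i + 4" "i + 3 + 1 = i + 4"
        by simp_all
      then show ?thesis
        using meets_commute(2)[of "i + 4" i "i + 4"] by (simp only:)
    qed
    also have "\<dots> \<le> 2 * meets (i + 3) (i + 3) (i + 1)"
      by (rule meets_square)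
    also have "meets (i + 3) (i + 3) (i + 1) = meets l (l + 2) (l + 2)"
    proof -
      have "i + 1 = l" "i + 3 = l + 2"
        using Suc by simp_all
      then show ?thesis
        using meets_commute(2)[of "l + 2" "l + 2" l] meets_commute(1)[of "l + 2" l "l + 2"]
        by (simp only:)
    qed
    finally show ?thesis .
  qed
  also have "\<dots> = 2 * balanced_meets n"
    using 3 by (simp only: balanced_meets_simps)
  finally show ?thesis .
next
  case (4 m)
  have "n + 1 = 3 * (m + 1)" using 4 by simp
  then have "balanced_meets (n + 1) = meets (m + 1) (m + 1) (m + 1)"
    by (simp only: balanced_meets_simps)
  also have "\<dots> \<le> 2 * balanced_meets n"
    using meets_square[of m "m + 1"] 4
    by (simp only: balanced_meets_simps add.assoc one_add_one)
  finally show ?thesis .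
qed

lemma balanced_meets_add2: "2 * balanced_meets n \<le> balanced_meets (n + 2)"
proof (cases n rule: nat_mod3_cases)
  case (1 m)
  moreover have "meets (m + 2) m m = meets m m (m + 2)"
    using meets_commute by metis
  ultimately show ?thesis
    using meets_add2[of m m m] by (simp only: balanced_meets_simps)
next
  case 2
  then have "n + 2 = 3 * 1" by simp
  then have "balanced_meets (n + 2) = meets 1 1 1"
    by (simp only: balanced_meets_simps)
  then show ?thesis using 2 balanced_meets_simps(2)
    by (simp add: meets_def walk_sum_Suc)
next
  case (3 m)
  have "n + 2 = 3 * (m + 2)" using 3 by simp
  then have "balanced_meets (n + 2) = meets (m + 2) (m + 2) (m + 2)"
    by (simp only: balanced_meets_simps)
  then show ?thesis
    using meets_add2[of m "m + 2" "m + 2"] 3 by (simp only: balanced_meets_simps)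
next
  case (4 m)
  have "n + 2 = 3 * m + 4" using 4 by simp
  then have "balanced_meets (n + 2) = meets (m + 2) m (m + 2)"
    by (simp only: balanced_meets_simps meets_commute(1)[of m])
  then show ?thesis
    using meets_add2[of m m "m + 2"] 4 by (simp only: balanced_meets_simps)
qed

text \<open>Two more steps at least double the number and one more step at most doubles it, so
  a single step cannot decrease it.\<close>

lemma balanced_meets_mono: "m \<le> n \<Longrightarrow> balanced_meets m \<le> balanced_meets n"
proof (rule lift_Suc_mono_le[of balanced_meets])
  fix n
  have "2 * balanced_meets n \<le> 2 * balanced_meets (n + 1)"
    using balanced_meets_add2[of n] balanced_meets_Suc_le[of "n + 1"] by simp
  then show "balanced_meets n \<le> balanced_meets (Suc n)" by simp
qed

lemma balanced_meets_add_le: "balanced_meets (n + d) \<le> 2 ^ d * balanced_meets n"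
proof (induction d)
  case (Suc d)
  then show ?case using balanced_meets_Suc_le[of "n + d"] by simp
qed simp

section \<open>Splitters as triples of walks\<close>

text \<open>The membership signs of a subset of \<open>U\<close> are the steps of a walk of length \<open>card U\<close>.\<close>

lemma sum_Pow_walk_sum:
  assumes "finite U"
  shows "(\<Sum>A\<in>Pow U. f (2 * int (card A) - int (card U))) = walk_sum (card U) f"
  using assms
proof (induction U arbitrary: f)
  case empty
  then show ?case by (simp add: walk_sum_def)
next
  case (insert x U)
  have inj: "inj_on (insert x) (Pow U)"
    using insert(2) by (auto simp: inj_on_def)
  have "(\<Sum>A\<in>insert x ` Pow U. f (2 * int (card A) - int (card (insert x U))))
    = (\<Sum>A\<in>Pow U. f (2 * int (card A) - int (card U) + 1))"
  proof (subst sum.reindex[OF inj], rule sum.cong[OF refl], goal_cases)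
    case (1 A)
    then have "finite A" "x \<notin> A" using insert finite_subset by auto
    then show ?case using insert by (simp add: algebra_simps)
  qed
  moreover have "(\<Sum>A\<in>Pow U. f (2 * int (card A) - int (card (insert x U))))
    = (\<Sum>A\<in>Pow U. f (2 * int (card A) - int (card U) - 1))"
    using insert by (simp add: algebra_simps)
  moreover have "Pow U \<inter> insert x ` Pow U = {}"
    using insert(2) by auto
  ultimately have "(\<Sum>A\<in>Pow (insert x U). f (2 * int (card A) - int (card (insert x U))))
    = (\<Sum>A\<in>Pow U. f (2 * int (card A) - int (card U) - 1) + f (2 * int (card A) - int (card U) + 1))"
    using insert(1) by (simp add: Pow_insert sum.union_disjoint sum.distrib)
  also have "\<dots> = walk_sum (card U) (\<lambda>s. f (s - 1) + f (s + 1))"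
    using insert.IH[of "\<lambda>s. f (s - 1) + f (s + 1)"] by simp
  finally show ?case using insert by (simp add: walk_sum_Suc)
qed

lemma sum_Pow_Un:
  assumes "U \<inter> V = {}"
  shows "(\<Sum>A\<in>Pow (U \<union> V). g (A \<inter> U) (A \<inter> V)) = (\<Sum>A\<in>Pow U. \<Sum>B\<in>Pow V. g A B)"
proof -
  have inv: "A \<inter> U \<union> A \<inter> V = A" if "A \<in> Pow (U \<union> V)" for A
    using that by auto
  have "(\<Sum>A\<in>Pow (U \<union> V). g (A \<inter> U) (A \<inter> V)) = (\<Sum>(A, B)\<in>Pow U \<times> Pow V. g A B)"
    by (rule sum.reindex_bij_witness[of _ "\<lambda>(A, B). A \<union> B" "\<lambda>A. (A \<inter> U, A \<inter> V)"])
      (use assms in \<open>auto simp: inv\<close>)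
  then show ?thesis
    by (simp add: sum.cartesian_product)
qed

lemma splits_iff_abs:
  assumes "finite B"
  shows "splits A B \<longleftrightarrow> \<bar>2 * int (card (A \<inter> B)) - int (card B)\<bar> \<le> 1"
proof -
  have "(if even m then n = m div 2 else n = (m - 1) div 2 \<or> n = (m + 1) div 2)
    \<longleftrightarrow> m \<le> 2 * n + 1 \<and> 2 * n \<le> m + 1" for m n :: nat
    by (auto elim!: evenE oddE)
  moreover have "\<bar>2 * int n - int m\<bar> \<le> 1 \<longleftrightarrow> m \<le> 2 * n + 1 \<and> 2 * n \<le> m + 1" for m n :: nat
    by linarith
  ultimately show ?thesis
    unfolding splits_def by simp
qed

text \<open>A walk of length \<open>n\<close> that ends next to \<open>- t\<close> extends uniquely by one step to a walk that
  ends at \<open>- t\<close>, and by symmetry \<open>t\<close> can replace \<open>- t\<close>.\<close>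

lemma walk_sum_near_opposite:
  "walk_sum n (\<lambda>s. if \<bar>s + t\<bar> \<le> 1 then 1 else 0) = walks n t + walks (Suc n) t"
proof -
  have "(\<lambda>s. if \<bar>s + t\<bar> \<le> 1 then 1 else (0::int)) = (\<lambda>s. (if s = - t then 1 else 0)
    + ((if s = - (t + 1) then 1 else 0) + (if s = - (t - 1) then 1 else 0)))"
    by (intro ext) auto
  then have "walk_sum n (\<lambda>s. if \<bar>s + t\<bar> \<le> 1 then 1 else 0)
    = walk_sum n (\<lambda>s. if s = - t then 1 else 0)
    + (walk_sum n (\<lambda>s. if s = - (t + 1) then 1 else 0) + walk_sum n (\<lambda>s. if s = - (t - 1) then 1 else 0))"
    by (simp only: walk_sum_def sum.distrib distrib_left)
  then show ?thesis
    unfolding walk_sum_indicator walks_minus by simp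
qed

text \<open>Only one of the two summands in \<open>walk_sum_near_opposite\<close> has the right parity; it belongs to
  \<open>a\<close> rounded up to the parity of \<open>b\<close>.\<close>

definition round_parity :: "nat \<Rightarrow> nat \<Rightarrow> nat" where
  "round_parity b a = (if even (a + b) then a else a + 1)"

lemma walk_sum_near_opposite_parity:
  assumes "even (int b + t)"
  shows "walk_sum a (\<lambda>s. if \<bar>s + t\<bar> \<le> 1 then 1 else 0) = walks (round_parity b a) t"
proof (cases "even (a + b)")
  case True
  then have "walks (Suc a) t = 0" using assms by (intro walks_parity) auto
  then show ?thesis using True by (simp only: walk_sum_near_opposite round_parity_def) simp
next
  case False
  then have "walks a t = 0" using assms by (intro walks_parity) auto
  then show ?thesis using False by (simp only: walk_sum_near_opposite round_parity_def) simp
qed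

text \<open>A splitter is cut into its traces on the four cells. The balance condition for each of the two
  sets only involves the excess \<open>e\<close> on its outer cell and on the middle cell, so that the count
  factors once the trace on the middle cell is fixed. The trace on the fourth cell is free.\<close>

lemma card_splitters_eq_meets:
  assumes B: "B1 \<subseteq> {1..k}" "B2 \<subseteq> {1..k}" and arr: "arrangement k B1 B2 = (a1, b, a2, d)"
  shows "int (card (splitters k {B1, B2})) = 2 ^ d * meets b (round_parity b a1) (round_parity b a2)"
proof -
  define Y X1 X2 Z where "Y = B1 \<inter> B2" and "X1 = B1 - B2" and "X2 = B2 - B1"
    and "Z = ({1..k} - B1) \<inter> ({1..k} - B2)"
  note defs = Y_def X1_def X2_def Z_def
  have fin: "finite B1" "finite B2" "finite Y" "finite X1" "finite X2" "finite Z"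
    using B by (auto simp: defs intro: finite_subset)
  have cards: "card X1 = a1" "card Y = b" "card X2 = a2" "card Z = d"
    using arr by (simp_all add: arrangement_def defs)
  have univ: "{1..k} = Y \<union> (X1 \<union> (X2 \<union> Z))"
    using B by (auto simp: defs)
  have disj: "Y \<inter> (X1 \<union> (X2 \<union> Z)) = {}" "X1 \<inter> (X2 \<union> Z) = {}" "X2 \<inter> Z = {}"
    by (auto simp: defs)
  define near :: "int \<Rightarrow> int \<Rightarrow> int" where "near t s = (if \<bar>s + t\<bar> \<le> 1 then 1 else 0)" for t s
  define e where "e U A = 2 * int (card A) - int (card U)" for U A :: "nat set"
  have near: "(if splits A (X \<union> Y) then 1 else 0) = near (e Y (A \<inter> Y)) (e X (A \<inter> X))"
    if "X = X1 \<or> X = X2" for X A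
  proof -
    have "finite X" "X \<inter> Y = {}" using that fin by (auto simp: defs)
    moreover from this have "card (A \<inter> (X \<union> Y)) = card (A \<inter> X) + card (A \<inter> Y)"
      using fin by (subst Int_Un_distrib, subst card_Un_disjoint) auto
    ultimately show ?thesis
      using fin by (simp add: splits_iff_abs near_def e_def card_Un_disjoint algebra_simps)
  qed
  have B12: "B1 = X1 \<union> Y" "B2 = X2 \<union> Y"
    by (auto simp: defs)
  have "int (card (splitters k {B1, B2}))
      = (\<Sum>A\<in>Pow {1..k}. if splits A B1 \<and> splits A B2 then 1 else 0)"
    by (simp add: splitters_def Pow_def sum.If_cases Int_def conj_commute)
  also have "\<dots> = (\<Sum>A\<in>Pow {1..k}. (if splits A B1 then 1 else 0) * (if splits A B2 then 1 else 0))"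
    by (intro sum.cong) auto
  also have "\<dots> = (\<Sum>A\<in>Pow {1..k}. near (e Y (A \<inter> Y)) (e X1 (A \<inter> X1)) * near (e Y (A \<inter> Y)) (e X2 (A \<inter> X2)))"
    unfolding B12 by (simp only: near simp_thms)
  also have "\<dots> = (\<Sum>y\<in>Pow Y. \<Sum>x\<in>Pow X1. \<Sum>z\<in>Pow X2. \<Sum>w\<in>Pow Z.
      near (e Y y) (e X1 x) * near (e Y y) (e X2 z))"
    (is "_ = (\<Sum>y\<in>_. \<Sum>x\<in>_. \<Sum>z\<in>_. \<Sum>w\<in>_. ?g y x z)")
  proof -
    have "(\<Sum>A\<in>Pow {1..k}. ?g (A \<inter> Y) (A \<inter> X1) (A \<inter> X2))
      = (\<Sum>A\<in>Pow (Y \<union> (X1 \<union> (X2 \<union> Z))). (\<lambda>y V. ?g y (V \<inter> X1) (V \<inter> (X2 \<union> Z) \<inter> X2)) (A \<inter> Y) (A \<inter> (X1 \<union> (X2 \<union> Z))))"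
      unfolding univ by (intro sum.cong refl) (simp add: Int_assoc Int_absorb1 Int_absorb2 inf_sup_absorb sup_commute)
    also have "\<dots> = (\<Sum>y\<in>Pow Y. \<Sum>V\<in>Pow (X1 \<union> (X2 \<union> Z)). ?g y (V \<inter> X1) (V \<inter> (X2 \<union> Z) \<inter> X2))"
      using disj by (subst sum_Pow_Un) auto
    also have "\<dots> = (\<Sum>y\<in>Pow Y. \<Sum>x\<in>Pow X1. \<Sum>V\<in>Pow (X2 \<union> Z). ?g y x (V \<inter> X2))"
      by (intro sum.cong refl sum_Pow_Un[OF disj(2), where g = "\<lambda>x V. ?g _ x (V \<inter> X2)"])
    also have "\<dots> = (\<Sum>y\<in>Pow Y. \<Sum>x\<in>Pow X1. \<Sum>z\<in>Pow X2. \<Sum>w\<in>Pow Z. ?g y x z)"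
      by (intro sum.cong refl sum_Pow_Un[OF disj(3), where g = "\<lambda>z w. ?g _ _ z"])
    finally show ?thesis .
  qed
  also have "\<dots> = 2 ^ d * (\<Sum>y\<in>Pow Y. (\<Sum>x\<in>Pow X1. near (e Y y) (e X1 x)) * (\<Sum>z\<in>Pow X2. near (e Y y) (e X2 z)))"
    using fin cards by (simp add: card_Pow sum_distrib_left[symmetric] sum_distrib_right[symmetric])
  also have "(\<Sum>y\<in>Pow Y. (\<Sum>x\<in>Pow X1. near (e Y y) (e X1 x)) * (\<Sum>z\<in>Pow X2. near (e Y y) (e X2 z)))
      = (\<Sum>y\<in>Pow Y. walk_sum a1 (near (e Y y)) * walk_sum a2 (near (e Y y)))"
    using sum_Pow_walk_sum[OF fin(4)] sum_Pow_walk_sum[OF fin(5)] by (simp add: e_def[of X1] e_def[of X2] cards)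
  also have "\<dots> = walk_sum b (\<lambda>t. walk_sum a1 (near t) * walk_sum a2 (near t))"
    using sum_Pow_walk_sum[OF fin(3), of "\<lambda>t. walk_sum a1 (near t) * walk_sum a2 (near t)"]
    by (simp add: e_def cards)
  also have "\<dots> = meets b (round_parity b a1) (round_parity b a2)"
    unfolding meets_def near_def
    by (intro walk_sum_cong) (simp only: walk_sum_near_opposite_parity)
  finally show ?thesis .
qed

lemma split_count_eq_meets:
  "int (split_count (a1, b, a2, d)) = 2 ^ d * meets b (round_parity b a1) (round_parity b a2)"
proof -
  have "(a1, b, a2, d) \<in> arrangements (a1 + b + a2 + d)"
    by (simp add: arrangements_def)
  then obtain B1 B2 where "B1 \<subseteq> {1..a1 + b + a2 + d}" "B2 \<subseteq> {1..a1 + b + a2 + d}"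
    "arrangement (a1 + b + a2 + d) B1 B2 = (a1, b, a2, d)"
    using arrangement_exists by blast
  then show ?thesis
    using split_count_arrangement card_splitters_eq_meets by metis
qed

section \<open>Asymptotics of three walks of equal length\<close>

lemma walk_sum_even_length:
  "walk_sum (2 * n) f = (\<Sum>i\<in>{- int n..int n}. walks (2 * n) (2 * i) * f (2 * i))"
proof -
  have "walk_sum (2 * n) f = (\<Sum>s\<in>(\<lambda>i. 2 * i) ` {- int n..int n}. walks (2 * n) s * f s)"
    unfolding walk_sum_def
  proof (intro sum.mono_neutral_right ballI)
    fix s
    assume s: "s \<in> {- int (2 * n)..int (2 * n)} - (\<lambda>i. 2 * i) ` {- int n..int n}"
    have "odd s"
    proof
      assume "even s"
      then obtain i where "s = 2 * i" by blast
      with s show False by auto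
    qed
    then show "walks (2 * n) s * f s = 0"
      by (simp add: walks_parity)
  qed auto
  also have "\<dots> = (\<Sum>i\<in>{- int n..int n}. walks (2 * n) (2 * i) * f (2 * i))"
    by (subst sum.reindex) (auto simp: inj_on_def)
  finally show ?thesis .
qed

definition return_prob :: "nat \<Rightarrow> real" where
  "return_prob n = real_of_int (walks (2 * n) 0) / 4 ^ n"

lemma return_prob_Suc: "2 * (real n + 1) * return_prob (Suc n) = (2 * real n + 1) * return_prob n"
proof -
  have "(2 * int n + 2) * ((2 * int n + 2) * walks (2 * n + 2) 0)
      = (2 * int n + 2) * (4 * (2 * int n + 1) * walks (2 * n) 0)"
    using walks_two_steps[of "2 * n" 0] by (simp add: power2_eq_square algebra_simps)
  then have "(2 * int n + 2) * walks (2 * n + 2) 0 = 4 * (2 * int n + 1) * walks (2 * n) 0"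
    by (subst (asm) mult_cancel_left) auto
  then have "real_of_int ((2 * int n + 2) * walks (2 * n + 2) 0)
      = real_of_int (4 * (2 * int n + 1) * walks (2 * n) 0)"
    by (rule arg_cong)
  then show ?thesis
    unfolding return_prob_def by (simp add: field_simps del: walks.simps)
qed

lemma return_prob_pos: "0 < return_prob n"
proof (induction n)
  case 0
  then show ?case by (simp add: return_prob_def)
next
  case (Suc n)
  then have "0 < 2 * (real n + 1) * return_prob (Suc n)"
    unfolding return_prob_Suc by simp
  then show ?case by (simp add: zero_less_mult_iff)
qed

text \<open>The partial products of Wallis are determined by the central terms, by the recurrence
  \<open>return_prob_Suc\<close>.\<close>

lemma return_prob_wallis:
  "(\<Prod>k=1..n. (4 * real k ^ 2) / (4 * real k ^ 2 - 1)) = 1 / ((return_prob n)\<^sup>2 * (2 * real n + 1))"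
proof (induction n)
  case 0
  then show ?case by (simp add: return_prob_def)
next
  case (Suc n)
  define x u where "x = real n" and "u = return_prob n"
  have u: "0 < u" and x: "0 \<le> x" by (simp_all add: u_def x_def return_prob_pos)
  have ps: "return_prob (Suc n) = (2 * x + 1) * u / (2 * (x + 1))"
    using return_prob_Suc[of n] x by (simp add: x_def u_def field_simps)
  have d: "4 * (x + 1)\<^sup>2 - 1 = (2 * x + 1) * (2 * x + 3)"
    by (simp add: power2_eq_square algebra_simps)
  have "(\<Prod>k=1..Suc n. (4 * real k ^ 2) / (4 * real k ^ 2 - 1))
     = 1 / (u\<^sup>2 * (2 * x + 1)) * ((4 * (x + 1)\<^sup>2) / (4 * (x + 1)\<^sup>2 - 1))"
    using Suc by (simp add: x_def u_def add.commute)
  also have "\<dots> = 1 / (((2 * x + 1) * u / (2 * (x + 1)))\<^sup>2 * (2 * (x + 1) + 1))"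
    unfolding d using u x by (simp add: divide_simps) (simp add: power2_eq_square algebra_simps)
  finally show ?case
    using ps by (simp add: x_def add.commute)
qed

lemma return_prob_asymptotic: "(\<lambda>n. return_prob n * sqrt (real n)) \<longlonglongrightarrow> 1 / sqrt pi"
proof -
  have "(\<lambda>n. 1 / ((return_prob n)\<^sup>2 * (2 * real n + 1))) \<longlonglongrightarrow> pi / 2"
    using wallis unfolding return_prob_wallis .
  then have "(\<lambda>n. inverse (1 / ((return_prob n)\<^sup>2 * (2 * real n + 1)))) \<longlonglongrightarrow> inverse (pi / 2)"
    by (rule tendsto_inverse) simp
  moreover have "(\<lambda>n. real n / (2 * real n + 1)) \<longlonglongrightarrow> 1 / 2"
    by real_asymp
  ultimately have "(\<lambda>n. inverse (1 / ((return_prob n)\<^sup>2 * (2 * real n + 1))) * (real n / (2 * real n + 1)))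
      \<longlonglongrightarrow> inverse (pi / 2) * (1 / 2)"
    by (rule tendsto_mult)
  then have "(\<lambda>n. sqrt (inverse (1 / ((return_prob n)\<^sup>2 * (2 * real n + 1))) * (real n / (2 * real n + 1))))
      \<longlonglongrightarrow> sqrt (inverse (pi / 2) * (1 / 2))"
    by (rule tendsto_real_sqrt)
  moreover have "sqrt (inverse (1 / ((return_prob n)\<^sup>2 * (2 * real n + 1))) * (real n / (2 * real n + 1)))
      = return_prob n * sqrt (real n)" for n
  proof -
    have "inverse (1 / ((return_prob n)\<^sup>2 * (2 * real n + 1))) * (real n / (2 * real n + 1))
        = (return_prob n)\<^sup>2 * real n"
      by (simp add: field_simps add_nonneg_eq_0_iff)
    then show ?thesis
      using return_prob_pos[of n] by (simp add: real_sqrt_mult)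
  qed
  ultimately show ?thesis
    by (simp add: real_sqrt_divide)
qed

definition walk_ratio :: "nat \<Rightarrow> int \<Rightarrow> real" where
  "walk_ratio n i = real_of_int (walks (2 * n) (2 * i)) / real_of_int (walks (2 * n) 0)"

lemma walks_centre_pos: "0 < walks (2 * n) 0"
  using return_prob_pos[of n] by (simp add: return_prob_def zero_less_divide_iff)

lemma walk_ratio_nonneg: "0 \<le> walk_ratio n i"
  by (simp add: walk_ratio_def walks_nonneg)

lemma walk_ratio_abs: "walk_ratio n i = walk_ratio n (int (nat \<bar>i\<bar>))"
  using walks_minus[of "2 * n" "2 * i"] by (simp add: walk_ratio_def abs_if)

lemma walk_ratio_0: "walk_ratio n 0 = 1"
  using walks_centre_pos[of n] by (simp add: walk_ratio_def)

lemma walk_ratio_eq_0: "n < i \<Longrightarrow> walk_ratio n (int i) = 0"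
  by (simp add: walk_ratio_def walks_eq_0)

lemma walk_ratio_Suc:
  "walk_ratio n (int (Suc i)) = walk_ratio n (int i) * ((real n - real i) / (real n + real i + 1))"
proof -
  have "(2 * int n + 2 * int i + 2) * walks (2 * n) (2 * int (Suc i))
    = (2 * int n - 2 * int i) * walks (2 * n) (2 * int i)"
    using walks_shift[of "2 * n" "2 * int i"] by (simp add: algebra_simps)
  then have "real_of_int ((2 * int n + 2 * int i + 2) * walks (2 * n) (2 * int (Suc i)))
    = real_of_int ((2 * int n - 2 * int i) * walks (2 * n) (2 * int i))"
    by (rule arg_cong)
  then have "2 * (real n + real i + 1) * real_of_int (walks (2 * n) (2 * int (Suc i)))
    = 2 * (real n - real i) * real_of_int (walks (2 * n) (2 * int i))"
    by (simp add: algebra_simps)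
  then have "real_of_int (walks (2 * n) (2 * int (Suc i)))
    = real_of_int (walks (2 * n) (2 * int i)) * ((real n - real i) / (real n + real i + 1))"
    by (simp add: field_simps add_nonneg_eq_0_iff)
  then show ?thesis by (simp add: walk_ratio_def)
qed

lemma one_minus_le_exp: 
  fixes x :: real
  assumes "0 \<le> x"
  shows "1 - x \<le> (1 + x) * exp (- 2 * x)"
proof -
  define f where "f x = (1 + x) * exp (- 2 * x) - (1 - x)" for x :: real
  have "f 0 \<le> f x"
  proof (rule DERIV_nonneg_imp_nondecreasing[OF assms])
    fix y
    assume "0 \<le> y" "y \<le> x"
    have "(f has_real_derivative (1 - (1 + 2 * y) * exp (- 2 * y))) (at y)"
      unfolding f_def by (auto intro!: derivative_eq_intros simp: algebra_simps)
    moreover have "(1 + 2 * y) * exp (- 2 * y) \<le> exp (2 * y) * exp (- 2 * y)"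
      by (intro mult_right_mono exp_ge_add_one_self) simp
    then have "0 \<le> 1 - (1 + 2 * y) * exp (- 2 * y)"
      by (simp flip: exp_add)
    ultimately show "\<exists>z. (f has_real_derivative z) (at y) \<and> 0 \<le> z"
      by blast
  qed
  then show ?thesis by (simp add: f_def)
qed

text \<open>The quotient of consecutive ratios is \<open>(1 - x) / (1 + x) \<le> exp (- 2 * x)\<close> for
  \<open>x = (2 * i + 1) / (2 * n + 1)\<close>, and the odd numbers \<open>2 * i + 1\<close> sum up to a square.\<close>

lemma walk_ratio_le_exp: "walk_ratio n (int i) \<le> exp (- (2 * (real i)\<^sup>2 / (2 * real n + 1)))"
proof (induction i)
  case (Suc i)
  show ?case
  proof (cases "i < n")
    case False
    then show ?thesis using walk_ratio_eq_0[of n "Suc i"] by (simp del: of_nat_Suc)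
  next
    case True
    define N x where "N = 2 * real n + 1" and "x = (2 * real i + 1) / N"
    have N: "0 < N" and x: "0 \<le> x" by (simp_all add: N_def x_def)
    have "(real n - real i) / (real n + real i + 1) = (1 - x) / (1 + x)"
      by (simp add: x_def N_def field_simps add_nonneg_eq_0_iff)
    also have "\<dots> \<le> exp (- 2 * x)"
      using one_minus_le_exp[OF x] x by (simp add: field_simps)
    finally have "walk_ratio n (int (Suc i)) \<le> exp (- (2 * (real i)\<^sup>2 / (2 * real n + 1))) * exp (- 2 * x)"
      unfolding walk_ratio_Suc using Suc True by (intro mult_mono) auto
    also have "\<dots> = exp (- (2 * (real i)\<^sup>2 / N + 2 * x))"
      by (simp add: N_def flip: exp_add)
    also have "2 * (real i)\<^sup>2 / N + 2 * x = 2 * (real (Suc i))\<^sup>2 / (2 * real n + 1)"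
      unfolding N_def[symmetric] x_def using N by (simp add: field_simps power2_eq_square)
    finally show ?thesis .
  qed
qed (simp add: walk_ratio_0)

text \<open>The length \<open>3 * n + 1\<close> is chosen so that \<open>2 * (3 * n + 1) + 1 = 3 * N\<close> for \<open>N = 2 * n + 1\<close>. With
  \<open>u = 2 * i + 1\<close> the quotients of consecutive ratios are then \<open>(N - u) / (N + u)\<close> on the left and
  \<open>((3 * N - u) / (3 * N + u)) ^ 3\<close> on the right. The latter is larger by the convexity of
  \<open>artanh\<close>, which here takes the form of a polynomial identity.\<close>

lemma walk_ratio_le_cube: "walk_ratio n (int i) \<le> walk_ratio (3 * n + 1) (int i) ^ 3"
proof (induction i)
  case (Suc i)
  show ?case
  proof (cases "i < n")
    case False
    then show ?thesis using walk_ratio_eq_0[of n "Suc i"] walk_ratio_nonneg by simp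
  next
    case True
    define x y where "x = real n" and "y = real i"
    have xy: "0 \<le> y" "y < x" using True by (simp_all add: x_def y_def)
    have "(3 * x + 1 - y) ^ 3 * (x + y + 1) - (x - y) * (3 * x + 2 + y) ^ 3
        = (2 * x + 1) * (2 * y + 1) ^ 3"
      by (simp add: power3_eq_cube algebra_simps)
    moreover have "0 \<le> (2 * x + 1) * (2 * y + 1) ^ 3"
      using xy by simp
    ultimately have "(x - y) * (3 * x + 2 + y) ^ 3 \<le> (3 * x + 1 - y) ^ 3 * (x + y + 1)"
      by linarith
    then have "(x - y) / (x + y + 1) \<le> (3 * x + 1 - y) ^ 3 / (3 * x + 2 + y) ^ 3"
      using xy by (simp add: divide_simps mult.commute)
    also have "\<dots> = ((3 * x + 1 - y) / (3 * x + 1 + y + 1)) ^ 3"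
      by (simp add: power_divide algebra_simps)
    finally have "(x - y) / (x + y + 1) \<le> ((3 * x + 1 - y) / (3 * x + 1 + y + 1)) ^ 3" .
    then have "walk_ratio n (int i) * ((x - y) / (x + y + 1))
      \<le> walk_ratio (3 * n + 1) (int i) ^ 3 * ((3 * x + 1 - y) / (3 * x + 1 + y + 1)) ^ 3"
      using Suc xy walk_ratio_nonneg by (intro mult_mono) auto
    then show ?thesis
      unfolding walk_ratio_Suc power_mult_distrib x_def y_def by (simp add: add.commute)
  qed
qed (simp add: walk_ratio_0)

text \<open>Comparison with the integral of the decreasing function \<open>exp (- x\<^sup>2)\<close> over the half line.\<close>

lemma sum_gaussian_le:
  assumes h: "0 < (h::real)"
  shows "(\<Sum>i=1..j. exp (- (h * real i)\<^sup>2)) \<le> sqrt pi / (2 * h)"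
proof -
  define e where "e x = exp (- (x::real)\<^sup>2)" for x
  have int: "e integrable_on {a..b}" for a b
    unfolding e_def by (intro integrable_continuous_interval continuous_intros)
  have "h * (\<Sum>i=1..j. e (h * real i)) \<le> integral {0..h * real j} e"
  proof (induction j)
    case (Suc j)
    have "h * e (h * real (Suc j)) = integral {h * real j..h * real (Suc j)} (\<lambda>x. e (h * real (Suc j)))"
      using h by (simp add: algebra_simps)
    also have "\<dots> \<le> integral {h * real j..h * real (Suc j)} e"
    proof (rule integral_le)
      fix x
      assume x: "x \<in> {h * real j..h * real (Suc j)}"
      then have "0 \<le> x" using h by (auto intro: order_trans[rotated])
      with x have "x\<^sup>2 \<le> (h * real (Suc j))\<^sup>2"
        by (intro power_mono) auto
      then show "e (h * real (Suc j)) \<le> e x" by (simp add: e_def)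
    qed (auto intro: int)
    finally have "h * (\<Sum>i=1..Suc j. e (h * real i))
      \<le> integral {0..h * real j} e + integral {h * real j..h * real (Suc j)} e"
      using Suc by (simp add: distrib_left)
    also have "\<dots> = integral {0..h * real (Suc j)} e"
      using h by (intro Henstock_Kurzweil_Integration.integral_combine int) auto
    finally show ?case .
  qed simp
  also have "integral {0..h * real j} e \<le> sqrt pi / 2"
  proof -
    have "((\<lambda>x. indicator {0..} x *\<^sub>R e x) has_integral (sqrt pi / 2)) UNIV"
      using gaussian_moment_0 has_integral_integral_lborel
      unfolding e_def has_bochner_integral_iff by metis
    then have half: "(e has_integral (sqrt pi / 2)) {0..}"
      by (subst (asm) indicator_scaleR_eq_if) (simp only: has_integral_restrict_UNIV)
    have "integral {0..h * real j} e \<le> integral {0..} e"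
      using half by (intro integral_subset_le int) (auto simp: e_def integrable_on_def)
    then show ?thesis using half by (simp add: integral_unique)
  qed
  finally show ?thesis using h by (simp add: e_def field_simps)
qed

lemma sum_symmetric_interval:
  fixes f :: "int \<Rightarrow> real"
  assumes "\<And>i. f (- i) = f i"
  shows "(\<Sum>i\<in>{- int j..int j}. f i) = f 0 + 2 * (\<Sum>i=1..j. f (int i))"
proof (induction j)
  case (Suc j)
  have "{- int (Suc j)..int (Suc j)} = insert (- int (Suc j)) (insert (int (Suc j)) {- int j..int j})"
    by auto
  then show ?case using Suc assms[of "int (Suc j)"] by simp
qed simp

text \<open>The Franel sum for walks of length \<open>2 * j\<close>, divided by the cube of its central term.\<close>

definition cubed_ratio_sum :: "nat \<Rightarrow> real" where
  "cubed_ratio_sum j = (\<Sum>i\<in>{- int j..int j}. walk_ratio j i ^ 3)"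

lemma meets_diagonal:
  "real_of_int (meets (2 * j) (2 * j) (2 * j)) / 2 ^ (6 * j) = return_prob j ^ 3 * cubed_ratio_sum j"
proof -
  have "real_of_int (meets (2 * j) (2 * j) (2 * j))
      = (\<Sum>i\<in>{- int j..int j}. real_of_int (walks (2 * j) (2 * i)) ^ 3)"
    by (simp add: meets_def walk_sum_even_length power3_eq_cube mult.assoc)
  also have "\<dots> = real_of_int (walks (2 * j) 0) ^ 3 * cubed_ratio_sum j"
    using walks_centre_pos[of j]
    by (simp add: cubed_ratio_sum_def walk_ratio_def sum_distrib_left power_divide)
  finally show ?thesis
    by (simp add: return_prob_def power_divide power_mult power3_eq_cube flip: power_mult_distrib)
qed

text \<open>The ratios of walks of length \<open>2 * n\<close> sum up to \<open>4 ^ n\<close> divided by the central term.\<close>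

lemma cubed_ratio_sum_lower: "1 / return_prob n \<le> cubed_ratio_sum (3 * n + 1)"
proof -
  have "real_of_int (walk_sum (2 * n) (\<lambda>_. 1)) = 4 ^ n"
    by (simp add: walk_sum_one power_mult)
  then have "(\<Sum>i\<in>{- int n..int n}. real_of_int (walks (2 * n) (2 * i))) = 4 ^ n"
    by (simp add: walk_sum_even_length)
  then have "1 / return_prob n = (\<Sum>i\<in>{- int n..int n}. walk_ratio n i)"
    by (simp add: return_prob_def walk_ratio_def sum_divide_distrib[symmetric])
  also have "\<dots> \<le> (\<Sum>i\<in>{- int n..int n}. walk_ratio (3 * n + 1) i ^ 3)"
    using walk_ratio_le_cube walk_ratio_abs by (intro sum_mono) metis
  also have "\<dots> \<le> cubed_ratio_sum (3 * n + 1)"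
    unfolding cubed_ratio_sum_def by (intro sum_mono2) (auto simp: walk_ratio_nonneg)
  finally show ?thesis .
qed

lemma cubed_ratio_sum_upper: "cubed_ratio_sum j \<le> 1 + sqrt (pi * (2 * real j + 1) / 6)"
proof -
  define h where "h = sqrt (6 / (2 * real j + 1))"
  have h: "0 < h" "h\<^sup>2 = 6 / (2 * real j + 1)" by (simp_all add: h_def)
  have "cubed_ratio_sum j = walk_ratio j 0 ^ 3 + 2 * (\<Sum>i=1..j. walk_ratio j (int i) ^ 3)"
    unfolding cubed_ratio_sum_def
    by (rule sum_symmetric_interval) (metis walk_ratio_abs abs_minus_cancel)
  also have "(\<Sum>i=1..j. walk_ratio j (int i) ^ 3) \<le> (\<Sum>i=1..j. exp (- (h * real i)\<^sup>2))"
  proof (rule sum_mono)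
    fix i
    have "walk_ratio j (int i) ^ 3 \<le> exp (- (2 * (real i)\<^sup>2 / (2 * real j + 1))) ^ 3"
      by (intro power_mono walk_ratio_le_exp walk_ratio_nonneg)
    also have "\<dots> = exp (- (h * real i)\<^sup>2)"
      unfolding power_mult_distrib h by (simp flip: exp_of_nat_mult)
    finally show "walk_ratio j (int i) ^ 3 \<le> exp (- (h * real i)\<^sup>2)" .
  qed
  also have "\<dots> \<le> sqrt pi / (2 * h)"
    by (rule sum_gaussian_le) (rule h)
  also have "walk_ratio j 0 ^ 3 + 2 * (sqrt pi / (2 * h)) = 1 + sqrt (pi * (2 * real j + 1) / 6)"
    by (simp add: walk_ratio_0 h_def real_sqrt_divide real_sqrt_mult)
  finally show ?thesis by simp
qed

lemma cubed_ratio_sum_asymptotic: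
  "(\<lambda>n. cubed_ratio_sum (3 * n + 1) / sqrt (real (3 * n + 1))) \<longlonglongrightarrow> sqrt (pi / 3)"
proof (rule tendsto_sandwich)
  show "\<forall>\<^sub>F n in sequentially. 1 / (return_prob n * sqrt (real n)) * sqrt (real n / real (3 * n + 1))
      \<le> cubed_ratio_sum (3 * n + 1) / sqrt (real (3 * n + 1))"
    using eventually_gt_at_top[of 0]
  proof eventually_elim
    case (elim n)
    have "1 / (return_prob n * sqrt (real n)) * sqrt (real n / real (3 * n + 1))
        = 1 / return_prob n / sqrt (real (3 * n + 1))"
      using elim by (simp add: real_sqrt_divide del: of_nat_add of_nat_mult)
    also have "\<dots> \<le> cubed_ratio_sum (3 * n + 1) / sqrt (real (3 * n + 1))"
      by (intro divide_right_mono cubed_ratio_sum_lower) simp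
    finally show ?case .
  qed
  show "\<forall>\<^sub>F n in sequentially. cubed_ratio_sum (3 * n + 1) / sqrt (real (3 * n + 1))
      \<le> (1 + sqrt (pi * (2 * real (3 * n + 1) + 1) / 6)) / sqrt (real (3 * n + 1))"
    by (intro always_eventually allI divide_right_mono cubed_ratio_sum_upper) simp
  have third: "(\<lambda>n. real n / real (3 * n + 1)) \<longlonglongrightarrow> 1 / 3"
    by real_asymp
  have "(\<lambda>n. 1 / (return_prob n * sqrt (real n)) * sqrt (real n / real (3 * n + 1)))
      \<longlonglongrightarrow> 1 / (1 / sqrt pi) * sqrt (1 / 3)"
    by (intro tendsto_mult tendsto_divide[OF tendsto_const return_prob_asymptotic]
        tendsto_real_sqrt[OF third]) simp
  then show "(\<lambda>n. 1 / (return_prob n * sqrt (real n)) * sqrt (real n / real (3 * n + 1)))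
      \<longlonglongrightarrow> sqrt (pi / 3)"
    by (simp add: real_sqrt_divide)
  have split: "1 / sqrt B + sqrt pi * sqrt (A / 6 / B) = (1 + sqrt (pi * A / 6)) / sqrt B" for A B
    by (simp add: real_sqrt_mult real_sqrt_divide add_divide_distrib)
  have "(\<lambda>n. 1 / sqrt (real (3 * n + 1)) + sqrt pi * sqrt ((2 * real (3 * n + 1) + 1) / 6 / real (3 * n + 1)))
     \<longlonglongrightarrow> 0 + sqrt pi * sqrt (1 / 3)"
    by (intro tendsto_add tendsto_mult tendsto_const tendsto_real_sqrt; real_asymp)
  then show "(\<lambda>n. (1 + sqrt (pi * (2 * real (3 * n + 1) + 1) / 6)) / sqrt (real (3 * n + 1)))
     \<longlonglongrightarrow> sqrt (pi / 3)"
    unfolding split by (simp add: real_sqrt_divide)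
qed

lemma meets_diagonal_asymptotic:
  "(\<lambda>n. real_of_int (meets (6 * n + 2) (6 * n + 2) (6 * n + 2)) / 2 ^ (18 * n + 6) * real (18 * n + 6))
     \<longlonglongrightarrow> 2 * sqrt 3 / pi"
proof -
  define j where "j n = 3 * n + 1" for n :: nat
  have "filterlim j sequentially sequentially"
    unfolding j_def by (intro filterlim_subseq) (auto simp: strict_mono_def)
  then have "(\<lambda>n. return_prob (j n) * sqrt (real (j n))) \<longlonglongrightarrow> 1 / sqrt pi"
    by (rule filterlim_compose[OF return_prob_asymptotic])
  then have "(\<lambda>n. 6 * (return_prob (j n) * sqrt (real (j n))) ^ 3 * (cubed_ratio_sum (j n) / sqrt (real (j n))))
      \<longlonglongrightarrow> 6 * (1 / sqrt pi) ^ 3 * sqrt (pi / 3)"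
    using cubed_ratio_sum_asymptotic unfolding j_def by (intro tendsto_mult tendsto_power tendsto_const)
  moreover have "6 * (1 / sqrt pi) ^ 3 * sqrt (pi / 3) = 2 * sqrt 3 / pi"
    by (simp add: power3_eq_cube real_sqrt_divide field_simps)
  moreover have "6 * (return_prob (j n) * sqrt (real (j n))) ^ 3 * (cubed_ratio_sum (j n) / sqrt (real (j n)))
      = real_of_int (meets (6 * n + 2) (6 * n + 2) (6 * n + 2)) / 2 ^ (18 * n + 6) * real (18 * n + 6)" for n
  proof -
    have eq: "2 * j n = 6 * n + 2" "6 * j n = 18 * n + 6" by (simp_all add: j_def)
    have "0 < real (j n)" by (simp add: j_def)
    then have cancel: "sqrt (real (j n)) ^ 3 / sqrt (real (j n)) = real (j n)"
      by (simp add: power3_eq_cube)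
    have "6 * (return_prob (j n) * sqrt (real (j n))) ^ 3 * (cubed_ratio_sum (j n) / sqrt (real (j n)))
       = return_prob (j n) ^ 3 * cubed_ratio_sum (j n) * (6 * (sqrt (real (j n)) ^ 3 / sqrt (real (j n))))"
      by (simp add: power_mult_distrib)
    also have "\<dots> = return_prob (j n) ^ 3 * cubed_ratio_sum (j n) * real (6 * j n)"
      unfolding cancel by simp
    finally show ?thesis
      unfolding meets_diagonal[symmetric] eq .
  qed
  ultimately show ?thesis by simp
qed

section \<open>The minimum over all arrangements\<close>

text \<open>Rounding up only increases the total length, and each point outside both sets contributes a
  factor \<open>2\<close>, at least as much as a further step does.\<close>

lemma split_count_ge:
  assumes "q \<in> arrangements k"
  shows "balanced_meets k \<le> int (split_count q)"
proof -
  obtain a1 b a2 d where q: "q = (a1, b, a2, d)" and k: "a1 + b + a2 + d = k"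
    using assms by (auto simp: arrangements_def)
  define p r where "p = round_parity b a1" and "r = round_parity b a2"
  have par: "even (b + p)" "even (p + r)" and ge: "a1 \<le> p" "a2 \<le> r"
    by (auto simp: p_def r_def round_parity_def)
  have "balanced_meets k \<le> balanced_meets (b + p + r + d)"
    using k ge by (intro balanced_meets_mono) simp
  also have "\<dots> \<le> 2 ^ d * balanced_meets (b + p + r)"
    by (rule balanced_meets_add_le)
  also have "\<dots> \<le> 2 ^ d * meets b p r"
    using balanced_meets_le[OF par] by simp
  also have "\<dots> = int (split_count q)"
    by (simp add: q split_count_eq_meets p_def r_def)
  finally show ?thesis .
qed

lemma is_arg_min_split_count:
  assumes "q \<in> arrangements k" "int (split_count q) = balanced_meets k"
  shows "is_arg_min split_count (\<lambda>q. q \<in> arrangements k) q"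
  using assms split_count_ge[of _ k] by (force simp: is_arg_min_def)

lemma balanced_arrangement:
  shows "(m, m, m, 0) \<in> arrangements (3 * m)"
    "int (split_count (m, m, m, 0)) = balanced_meets (3 * m)"
    "(m, m + 2, m + 2, 0) \<in> arrangements (3 * m + 4)"
    "int (split_count (m, m + 2, m + 2, 0)) = balanced_meets (3 * m + 4)"
    "(m, m, m + 2, 0) \<in> arrangements (3 * m + 2)"
    "int (split_count (m, m, m + 2, 0)) = balanced_meets (3 * m + 2)"
  unfolding balanced_meets_simps split_count_eq_meets
  using meets_commute(1)[of "m + 2" m "m + 2"]
  by (simp_all add: arrangements_def round_parity_def del: add_2_eq_Suc')

lemma min_split_count_eq:
  assumes "k \<noteq> 1"
  shows "int (min_split_count k) = balanced_meets k"
proof -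
  obtain q where q: "q \<in> arrangements k" "int (split_count q) = balanced_meets k"
    using assms balanced_arrangement by (cases k rule: nat_mod3_cases) blast+
  have "arrangements k \<subseteq> {..k} \<times> {..k} \<times> {..k} \<times> {..k}"
    by (auto simp: arrangements_def)
  then have "finite (arrangements k)"
    by (rule finite_subset) simp
  then have "min_split_count k = split_count q"
    unfolding min_split_count_def
  proof (intro Min_eqI)
    fix n
    assume "n \<in> split_count ` arrangements k"
    then show "split_count q \<le> n"
      using split_count_ge q(2) by force
  qed (use q(1) in auto)
  with q(2) show ?thesis by simp
qed

text \<open>A monotone sequence that behaves like \<open>c / k\<close> along an arithmetic progression does so everywhere,
  since consecutive members of the progression have asymptotic ratio \<open>1\<close>.\<close>

lemma antimono_times_index_tendsto:
  fixes f :: "nat \<Rightarrow> real"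
  assumes anti: "antimono f" and nonneg: "\<And>n. 0 \<le> f n" and a: "0 < a"
    and lim: "(\<lambda>n. f (a * n + b) * real (a * n + b)) \<longlonglongrightarrow> c"
  shows "(\<lambda>k. f k * real k) \<longlonglongrightarrow> c"
proof -
  define r where "r k = (k - b) div a" for k
  have r: "filterlim r at_top sequentially"
    unfolding filterlim_at_top
  proof
    fix Z
    show "\<forall>\<^sub>F k in sequentially. Z \<le> r k"
      using eventually_ge_at_top[of "a * Z + b"]
    proof eventually_elim
      case (elim k)
      then have "a * Z \<le> k - b" by simp
      then show ?case
        unfolding r_def using a by (simp add: less_eq_div_iff_mult_less_eq mult.commute)
    qed
  qed
  have bounds: "a * r k + b \<le> k" "k \<le> a * Suc (r k) + b" if "b \<le> k" for k
  proof -
    have "a * r k + (k - b) mod a = k - b" "(k - b) mod a < a"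
      using a by (simp_all add: r_def)
    then show "a * r k + b \<le> k" "k \<le> a * Suc (r k) + b"
      using that unfolding mult_Suc_right by linarith+
  qed
  define g where "g = (\<lambda>n. f (a * n + b) * real (a * n + b))"
  have cancel: "x * y * (z / y) = x * z" if "0 < y" for x y z :: real
    using that by simp
  have up: "(\<lambda>n. g n * (real (a * Suc n + b) / real (a * n + b))) \<longlonglongrightarrow> c * 1"
  proof (intro tendsto_mult)
    show "g \<longlonglongrightarrow> c" using lim unfolding g_def .
    have "0 < real a" using a by simp
    then show "(\<lambda>n. real (a * Suc n + b) / real (a * n + b)) \<longlonglongrightarrow> 1"
      by real_asymp
  qed
  have low: "(\<lambda>n. g (Suc n) * (real (a * n + b) / real (a * Suc n + b))) \<longlonglongrightarrow> c * 1"
  proof (intro tendsto_mult)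
    have "g \<longlonglongrightarrow> c" using lim unfolding g_def .
    then show "(\<lambda>n. g (Suc n)) \<longlonglongrightarrow> c" by (rule LIMSEQ_Suc)
    have "0 < real a" using a by simp
    then show "(\<lambda>n. real (a * n + b) / real (a * Suc n + b)) \<longlonglongrightarrow> 1"
      by real_asymp
  qed
  show ?thesis
  proof (rule tendsto_sandwich[OF _ _ filterlim_compose[OF low[unfolded mult_1_right] r]
        filterlim_compose[OF up[unfolded mult_1_right] r]])
    show "\<forall>\<^sub>F k in sequentially. g (Suc (r k)) * (real (a * r k + b) / real (a * Suc (r k) + b)) \<le> f k * real k"
      using eventually_ge_at_top[of b]
    proof eventually_elim
      case (elim k)
      have "0 < real (a * Suc (r k) + b)" using a unfolding of_nat_0_less_iff by simp
      then have "g (Suc (r k)) * (real (a * r k + b) / real (a * Suc (r k) + b))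
          = f (a * Suc (r k) + b) * real (a * r k + b)"
        unfolding g_def by (rule cancel)
      also have "\<dots> \<le> f k * real k"
        using bounds[OF elim] antimonoD[OF anti] nonneg by (intro mult_mono) (simp_all only: of_nat_le_iff of_nat_0_le_iff)
      finally show ?case .
    qed
    show "\<forall>\<^sub>F k in sequentially. f k * real k \<le> g (r k) * (real (a * Suc (r k) + b) / real (a * r k + b))"
      using eventually_ge_at_top[of "a + b"]
    proof eventually_elim
      case (elim k)
      have "0 < r k" using elim a by (simp add: r_def div_greater_zero_iff)
      then have "0 < real (a * r k + b)" using a unfolding of_nat_0_less_iff by simp
      then have eq: "g (r k) * (real (a * Suc (r k) + b) / real (a * r k + b))
          = f (a * r k + b) * real (a * Suc (r k) + b)"
        unfolding g_def by (rule cancel)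
      have "b \<le> k" using elim by simp
      then have "f k * real k \<le> f (a * r k + b) * real (a * Suc (r k) + b)"
        using bounds[of k] antimonoD[OF anti] nonneg by (intro mult_mono) (simp_all only: of_nat_le_iff of_nat_0_le_iff)
      then show ?case using eq by simp
    qed
  qed
qed

text \<open>The progression \<open>18 * n + 6\<close> consists of the total lengths of three walks of length
  \<open>2 * (3 * n + 1)\<close>.\<close>

lemma balanced_meets_asymptotic:
  "(\<lambda>k. real_of_int (balanced_meets k) / 2 ^ k * real k) \<longlonglongrightarrow> 2 * sqrt 3 / pi"
proof (rule antimono_times_index_tendsto[where a = 18 and b = 6])
  have "real_of_int (balanced_meets (Suc k)) / 2 ^ Suc k \<le> real_of_int (balanced_meets k) / 2 ^ k" for k
    using balanced_meets_Suc_le[of k] by (simp add: field_simps flip: of_int_le_iff[where 'a = real])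
  then show "antimono (\<lambda>k. real_of_int (balanced_meets k) / 2 ^ k)"
    by (rule decseq_SucI)
  have "0 \<le> balanced_meets k" for k
    using balanced_meets_mono[of 0 k] balanced_meets_simps(1)[of 0] by (simp add: meets_def)
  then show "0 \<le> real_of_int (balanced_meets k) / 2 ^ k" for k by simp
  have "balanced_meets (18 * n + 6) = meets (6 * n + 2) (6 * n + 2) (6 * n + 2)" for n
    using balanced_meets_simps(1)[of "6 * n + 2"] by (simp add: algebra_simps)
  then show "(\<lambda>n. real_of_int (balanced_meets (18 * n + 6)) / 2 ^ (18 * n + 6) * real (18 * n + 6))
      \<longlonglongrightarrow> 2 * sqrt 3 / pi"
    using meets_diagonal_asymptotic by simp
qed simp

lemma min_split_count_asymptotic:
  "(\<lambda>k. real (min_split_count k)) \<sim>[at_top] (\<lambda>k. (2 * sqrt 3 / pi) * (2 ^ k / real k))"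
proof (rule asymp_equivI')
  have "(\<lambda>k. real_of_int (balanced_meets k) / 2 ^ k * real k / (2 * sqrt 3 / pi))
      \<longlonglongrightarrow> (2 * sqrt 3 / pi) / (2 * sqrt 3 / pi)"
    by (intro tendsto_divide balanced_meets_asymptotic tendsto_const) simp
  moreover have "\<forall>\<^sub>F k in sequentially. real_of_int (balanced_meets k) / 2 ^ k * real k / (2 * sqrt 3 / pi)
      = real (min_split_count k) / ((2 * sqrt 3 / pi) * (2 ^ k / real k))"
    using eventually_gt_at_top[of 1]
  proof eventually_elim
    case (elim k)
    then have "real_of_int (int (min_split_count k)) = real_of_int (balanced_meets k)"
      using min_split_count_eq[of k] by simp
    then show ?case using elim by (simp add: mult_ac)
  qed
  ultimately show "(\<lambda>k. real (min_split_count k) / ((2 * sqrt 3 / pi) * (2 ^ k / real k))) \<longlonglongrightarrow> 1"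
    by (simp add: tendsto_cong)
qed

theorem theorem4p2:
  shows "(\<forall>k m. k mod 3 = 0 \<longrightarrow> m = k div 3 \<longrightarrow>
            is_arg_min split_count (\<lambda>q. q \<in> arrangements k) (m, m, m, 0))
       \<and> (\<forall>k m. k mod 3 = 1 \<longrightarrow> k \<noteq> 1 \<longrightarrow> m = (k + 2) div 3 \<longrightarrow>
            is_arg_min split_count (\<lambda>q. q \<in> arrangements k) (m - 2, m, m, 0))
       \<and> (\<forall>k m. k mod 3 = 2 \<longrightarrow> m = (k - 2) div 3 \<longrightarrow>
            is_arg_min split_count (\<lambda>q. q \<in> arrangements k) (m, m, m + 2, 0))
       \<and> (\<lambda>k. real (min_split_count k)) \<sim>[at_top] (\<lambda>k. (2 * sqrt 3 / pi) * (2 ^ k / real k))"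
proof (intro conjI allI impI)
  fix k m :: nat
  assume "k mod 3 = 0" "m = k div 3"
  then have "k = 3 * m" by presburger
  then show "is_arg_min split_count (\<lambda>q. q \<in> arrangements k) (m, m, m, 0)"
    using balanced_arrangement(1,2) by (simp only: is_arg_min_split_count)
next
  fix k m :: nat
  assume "k mod 3 = 1" "k \<noteq> 1" "m = (k + 2) div 3"
  then have "k = 3 * (m - 2) + 4" "m = m - 2 + 2" by presburger+
  then show "is_arg_min split_count (\<lambda>q. q \<in> arrangements k) (m - 2, m, m, 0)"
    using is_arg_min_split_count[OF balanced_arrangement(3,4)[of "m - 2"]] by simp
next
  fix k m :: nat
  assume "k mod 3 = 2" "m = (k - 2) div 3"
  then have "k = 3 * m + 2" by presburger
  then show "is_arg_min split_count (\<lambda>q. q \<in> arrangements k) (m, m, m + 2, 0)"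
    using balanced_arrangement(5,6) by (simp only: is_arg_min_split_count)
qed (rule min_split_count_asymptotic)

end
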